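(* Let $\Gamma$ be a finitely generated group with property $(\tau)$. Then: (1) If $\Gamma$ has infinitely many finite-index subgroups, then $\Gamma$ is not BS-rigid. (2) If $\Gamma$ is infinite and sofic, then $\Gamma$ is not stable (in permutations).
   Context: Property $(\tau)$: a group $\Gamma$ generated by a finite set $S$ has property $(\tau)$ if there is $\kappa>0$ such that for every finite-dimensional unitary representation $\rho\colon\Gamma\to\mathcal{U}(\mathcal{H})$ that factors through a finite quotient of $\Gamma$, every $v\in\mathcal{H}$ and every $\varepsilon>0$: if $\|\rho(s)v-v\|\le\varepsilon\|v\|$ for all $s\in S$, then $\|v-Pv\|\le\frac{\varepsilon}{\kappa}\|v\|$, where $P$ is the orthogonal projection of $\mathcal{H}$ onto the subspace $\mathcal{H}^\Gamma$ of $\Gamma$-invariant vectors. Notation: write $[n]=\{1,\dots,n\}$, let $\mathrm{Sym}(n)$ be the symmetric group on $[n]$, and for $\sigma,\tau\in\mathrm{Sym}(n)$ let $d(\sigma,\tau)=\frac1n|\{x\in[n]\mid\sigma x\ne\tau x\}|$. For a function $f\colon\Gamma\to\mathrm{Sym}(n)$ and a finite set $Q\subset\Gamma$, let $N_{f,Q}$ be the probability distribution on the power set $2^Q$ of the random set $\{\gamma\in Q\mid f(\gamma)x=x\}$, where $x$ is uniform in $[n]$. Let $d_{\mathrm{TV}}(\theta_1,\theta_2)=\frac12\sum_{x\in\Omega}|\theta_1(x)-\theta_2(x)|$ for distributions on a finite set $\Omega$. Call a sequence of functions $(f_\ell\colon\Gamma\to\mathrm{Sym}(n_\ell))_{\ell=1}^\infty$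 with $n_\ell\to\infty$ an asymptotic homomorphism if $d(f_\ell(\gamma_1\gamma_2),f_\ell(\gamma_1)f_\ell(\gamma_2))\to0$ for all $\gamma_1,\gamma_2\in\Gamma$. Stability (in permutations): $\Gamma$ is stable if for every asymptotic homomorphism $(f_\ell\colon\Gamma\to\mathrm{Sym}(n_\ell))_{\ell=1}^\infty$ there is a sequence of homomorphisms $(h_\ell\colon\Gamma\to\mathrm{Sym}(n_\ell))_{\ell=1}^\infty$ with $d(f_\ell(\gamma),h_\ell(\gamma))\to0$ for all $\gamma\in\Gamma$. BS-rigidity (Benjamini--Schramm rigidity): $\Gamma$ is BS-rigid if for every asymptotic homomorphism $(f_\ell\colon\Gamma\to\mathrm{Sym}(n_\ell))_{\ell=1}^\infty$ the following holds: if there is a sequence of homomorphisms $(g_\ell\colon\Gamma\to\mathrm{Sym}(n_\ell))_{\ell=1}^\infty$ with $d_{\mathrm{TV}}(N_{f_\ell,Q},N_{g_\ell,Q})\to0$ for every finite $Q\subset\Gamma$, then there is a sequence of homomorphisms $(h_\ell\colon\Gamma\to\mathrm{Sym}(n_\ell))_{\ell=1}^\infty$ with $d(f_\ell(\gamma),h_\ell(\gamma))\to0$ for all $\gamma\in\Gamma$. Soficity: $\Gamma$ is sofic if there is an asymptotic homomorphism $(f_\ell\colon\Gamma\to\mathrm{Sym}(n_\ell))_{\ell=1}^\infty$ such that $d(f_\ell(\gamma),\mathrm{id})\to1$ for every non-identity element $\gamma\in\Gamma$. *)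

theory Defs
  imports
    "HOL-Algebra.Coset"
    "HOL-Algebra.Sym_Groups"
    "HOL-Probability.Probability_Mass_Function"
    "Jordan_Normal_Form.Schur_Decomposition"
begin

section \<open>Property tau\<close>

text \<open>A finite-dimensional complex Hilbert space is isometric to some \<open>\<complex>\<^sup>n\<close> with its standard
  Hermitian inner product \<open>v \<bullet>c w\<close> (linear in the first argument), so representation spaces are
  taken to be \<open>carrier_vec n\<close> with \<open>n\<close> arbitrary.\<close>

definition cvec_norm :: "complex vec \<Rightarrow> real" where
  "cvec_norm v = sqrt (Re (v \<bullet>c v))"

definition unitary_group :: "nat \<Rightarrow> complex mat monoid" where
  "unitary_group n =
    \<lparr> carrier = {U \<in> carrier_mat n n. U * mat_adjoint U = 1\<^sub>m n \<and> mat_adjoint U * U = 1\<^sub>m n},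
      monoid.mult = (*),
      one = 1\<^sub>m n \<rparr>"

definition factors_through_finite_quotient ::
    "('a, 'b) monoid_scheme \<Rightarrow> nat \<Rightarrow> ('a \<Rightarrow> complex mat) \<Rightarrow> bool" where
  "factors_through_finite_quotient G n \<rho> \<longleftrightarrow>
    (\<exists>N. N \<lhd> G \<and> finite (carrier (G Mod N)) \<and>
      (\<exists>\<rho>' \<in> hom (G Mod N) (unitary_group n). \<forall>g \<in> carrier G. \<rho> g = \<rho>' (N #>\<^bsub>G\<^esub> g)))"

definition invariant_vectors ::
    "('a, 'b) monoid_scheme \<Rightarrow> nat \<Rightarrow> ('a \<Rightarrow> complex mat) \<Rightarrow> complex vec set" where
  "invariant_vectors G n \<rho> = {v \<in> carrier_vec n. \<forall>g \<in> carrier G. \<rho> g *\<^sub>v v = v}"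

text \<open>The description below determines a unique vector whenever \<open>W\<close> is a linear subspace of
  \<open>carrier_vec n\<close> and \<open>v \<in> carrier_vec n\<close>.\<close>

definition orth_projection :: "complex vec set \<Rightarrow> complex vec \<Rightarrow> complex vec" where
  "orth_projection W v = (THE w. w \<in> W \<and> (\<forall>u \<in> W. (v - w) \<bullet>c u = 0))"

text \<open>Meant for a finite generating set \<open>S\<close> of \<open>G\<close>; the validity of the property does not depend
  on which one is chosen.\<close>

definition property_tau :: "('a, 'b) monoid_scheme \<Rightarrow> 'a set \<Rightarrow> bool" where
  "property_tau G S \<longleftrightarrow>
    (\<exists>\<kappa>::real. \<kappa> > 0 \<and>
      (\<forall>n. \<forall>\<rho> \<in> hom G (unitary_group n). factors_through_finite_quotient G n \<rho> \<longrightarrow>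
        (\<forall>v \<in> carrier_vec n. \<forall>\<epsilon>>0.
          (\<forall>s \<in> S. cvec_norm (\<rho> s *\<^sub>v v - v) \<le> \<epsilon> * cvec_norm v) \<longrightarrow>
          cvec_norm (v - orth_projection (invariant_vectors G n \<rho>) v) \<le> \<epsilon> / \<kappa> * cvec_norm v)))"

section \<open>Asymptotic homomorphisms into symmetric groups\<close>

definition perm_dist :: "nat \<Rightarrow> (nat \<Rightarrow> nat) \<Rightarrow> (nat \<Rightarrow> nat) \<Rightarrow> real" where
  "perm_dist n \<sigma> \<tau> = real (card {x \<in> {1..n}. \<sigma> x \<noteq> \<tau> x}) / real n"

text \<open>The degrees \<open>n l\<close> are required to be positive since neither \<open>perm_dist n\<close> nor the uniform
  distribution on \<open>{1..n}\<close> is meaningful for \<open>n = 0\<close>.\<close>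

definition asymptotic_hom ::
    "('a, 'b) monoid_scheme \<Rightarrow> (nat \<Rightarrow> nat) \<Rightarrow> (nat \<Rightarrow> 'a \<Rightarrow> nat \<Rightarrow> nat) \<Rightarrow> bool" where
  "asymptotic_hom G n f \<longleftrightarrow>
    (\<forall>l. n l > 0) \<and> filterlim n at_top sequentially \<and>
    (\<forall>l. f l \<in> carrier G \<rightarrow> carrier (sym_group (n l))) \<and>
    (\<forall>g \<in> carrier G. \<forall>h \<in> carrier G.
      (\<lambda>l. perm_dist (n l) (f l (g \<otimes>\<^bsub>G\<^esub> h)) (f l g \<otimes>\<^bsub>sym_group (n l)\<^esub> f l h)) \<longlonglongrightarrow> 0)"

definition close_to_homs ::
    "('a, 'b) monoid_scheme \<Rightarrow> (nat \<Rightarrow> nat) \<Rightarrow> (nat \<Rightarrow> 'a \<Rightarrow> nat \<Rightarrow> nat) \<Rightarrow> bool" where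
  "close_to_homs G n f \<longleftrightarrow>
    (\<exists>h. (\<forall>l. h l \<in> hom G (sym_group (n l))) \<and>
      (\<forall>g \<in> carrier G. (\<lambda>l. perm_dist (n l) (f l g) (h l g)) \<longlonglongrightarrow> 0))"

definition stable_in_permutations :: "('a, 'b) monoid_scheme \<Rightarrow> bool" where
  "stable_in_permutations G \<longleftrightarrow> (\<forall>n f. asymptotic_hom G n f \<longrightarrow> close_to_homs G n f)"

definition sofic :: "('a, 'b) monoid_scheme \<Rightarrow> bool" where
  "sofic G \<longleftrightarrow>
    (\<exists>n f. asymptotic_hom G n f \<and>
      (\<forall>g \<in> carrier G - {\<one>\<^bsub>G\<^esub>}. (\<lambda>l. perm_dist (n l) (f l g) id) \<longlonglongrightarrow> 1))"

section \<open>Benjamini--Schramm rigidity\<close>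

definition stabilizer_distr :: "nat \<Rightarrow> ('a \<Rightarrow> nat \<Rightarrow> nat) \<Rightarrow> 'a set \<Rightarrow> 'a set pmf" where
  "stabilizer_distr n f Q = map_pmf (\<lambda>x. {g \<in> Q. f g x = x}) (pmf_of_set {1..n})"

definition tv_dist :: "'c set \<Rightarrow> 'c pmf \<Rightarrow> 'c pmf \<Rightarrow> real" where
  "tv_dist \<Omega> p q = 1 / 2 * (\<Sum>x\<in>\<Omega>. \<bar>pmf p x - pmf q x\<bar>)"

definition BS_rigid :: "('a, 'b) monoid_scheme \<Rightarrow> bool" where
  "BS_rigid G \<longleftrightarrow>
    (\<forall>n f. asymptotic_hom G n f \<longrightarrow>
      (\<exists>k. (\<forall>l. k l \<in> hom G (sym_group (n l))) \<and>
        (\<forall>Q. finite Q \<and> Q \<subseteq> carrier G \<longrightarrow>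
          (\<lambda>l. tv_dist (Pow Q) (stabilizer_distr (n l) (f l) Q) (stabilizer_distr (n l) (k l) Q))
            \<longlonglongrightarrow> 0)) \<longrightarrow>
      close_to_homs G n f)"

end

theory Submission
  imports Defs
begin

text \<open>Infinitely many finite-index subgroups yield a strictly decreasing chain \<open>K i\<close> of normal
  subgroups of finite index. Delete one point from the action of \<open>G\<close> on \<open>G / K j\<close>, a perturbation of
  size \<open>O(1/n)\<close> of a transitive action on one point more. For a finite set \<open>Q\<close>, all stabilizers in a
  free \<open>G / K i\<close>-set meet \<open>Q\<close> in \<open>Q \<inter> K i\<close>, which is eventually constant in \<open>i\<close>; so the statistics
  of the perturbed action agree asymptotically with those of many copies of \<open>G / K l\<close> together with
  fewer than \<open>|G / K l|\<close> fixed points, when \<open>j\<close> is much larger than \<open>l\<close>. Property \<open>(\<tau>)\<close>, applied to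
  the permutation representation on pairs of points and the indicator function of the diagonal, shows
  that no action on \<open>n\<close> points is close to a transitive action on \<open>n + 1\<close> points. For the second
  part, a stable sofic group is residually finite, so if it is infinite the first part applies.\<close>

section \<open>Actions on finite sets\<close>

lemma sym_group_homD:
  assumes "\<phi> \<in> hom G (sym_group n)"
  shows "g \<in> carrier G \<Longrightarrow> \<phi> g permutes {1..n}"
    and "g \<in> carrier G \<Longrightarrow> h \<in> carrier G \<Longrightarrow> \<phi> (g \<otimes>\<^bsub>G\<^esub> h) x = \<phi> g (\<phi> h x)"
    and "group G \<Longrightarrow> \<phi> \<one>\<^bsub>G\<^esub> x = x"
  using hom_in_carrier[OF assms] hom_mult[OF assms] hom_one[OF assms _ sym_group_is_group]
  by (simp_all add: sym_group_def)

lemma (in group) hom_sym_groupI: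
  assumes closed: "\<And>g x. g \<in> carrier G \<Longrightarrow> x \<in> {1..n} \<Longrightarrow> \<phi> g x \<in> {1..n}"
    and outside: "\<And>g x. g \<in> carrier G \<Longrightarrow> x \<notin> {1..n} \<Longrightarrow> \<phi> g x = x"
    and one: "\<And>x. x \<in> {1..n} \<Longrightarrow> \<phi> \<one> x = x"
    and mult: "\<And>g h x. g \<in> carrier G \<Longrightarrow> h \<in> carrier G \<Longrightarrow> x \<in> {1..n} \<Longrightarrow>
      \<phi> (g \<otimes> h) x = \<phi> g (\<phi> h x)"
  shows "\<phi> \<in> hom G (sym_group n)"
proof -
  have mult': "\<phi> (g \<otimes> h) x = \<phi> g (\<phi> h x)" if "g \<in> carrier G" "h \<in> carrier G" for g h x
    using that mult outside by (cases "x \<in> {1..n}") auto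
  have one': "\<phi> \<one> x = x" for x
    using one outside by (cases "x \<in> {1..n}") auto
  have "\<phi> g permutes {1..n}" if g: "g \<in> carrier G" for g
  proof (rule bij_imp_permutes)
    show "bij_betw (\<phi> g) {1..n} {1..n}"
      using g closed mult'[of g "inv g"] mult'[of "inv g" g]
      by (intro bij_betw_byWitness[of _ "\<phi> (inv g)"]) (auto simp: one')
  qed (use g outside in auto)
  then show ?thesis
    by (auto intro!: homI simp: sym_group_def mult')
qed

lemma (in group) finite_action_hom_sym_group:
  assumes "finite X"
    and closed: "\<And>g x. g \<in> carrier G \<Longrightarrow> x \<in> X \<Longrightarrow> \<alpha> g x \<in> X"
    and one: "\<And>x. x \<in> X \<Longrightarrow> \<alpha> \<one> x = x"
    and mult: "\<And>g h x. g \<in> carrier G \<Longrightarrow> h \<in> carrier G \<Longrightarrow> x \<in> X \<Longrightarrow>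
      \<alpha> (g \<otimes> h) x = \<alpha> g (\<alpha> h x)"
  obtains e \<phi> where "bij_betw e {1..card X} X" and "\<phi> \<in> hom G (sym_group (card X))"
    and "\<And>g i. g \<in> carrier G \<Longrightarrow> i \<in> {1..card X} \<Longrightarrow> e (\<phi> g i) = \<alpha> g (e i)"
proof -
  let ?I = "{1..card X}"
  obtain e where e: "bij_betw e ?I X"
    using ex_bij_betw_nat_finite_1[OF \<open>finite X\<close>] by blast
  define e' where "e' = inv_into ?I e"
  have e': "e' x \<in> ?I" "e (e' x) = x" if "x \<in> X" for x
    using e that bij_betw_inv_into_right[OF e that] inv_into_into[of x e ?I]
    unfolding e'_def by (auto simp: bij_betw_def)
  have e'_e: "e' (e i) = i" if "i \<in> ?I" for i
    using bij_betw_inv_into_left[OF e that] by (simp add: e'_def)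
  have eX: "e i \<in> X" if "i \<in> ?I" for i
    using bij_betwE[OF e] that by blast
  define \<phi> where "\<phi> g i = (if i \<in> ?I then e' (\<alpha> g (e i)) else i)" for g i
  have eq: "e (\<phi> g i) = \<alpha> g (e i)" if "g \<in> carrier G" "i \<in> ?I" for g i
    using that e' closed eX by (simp add: \<phi>_def)
  have "\<phi> \<in> hom G (sym_group (card X))"
  proof (rule hom_sym_groupI)
    show in_I: "\<phi> g i \<in> ?I" if "g \<in> carrier G" "i \<in> ?I" for g i
      unfolding \<phi>_def using that e'(1)[OF closed[OF that(1) eX]] by simp
    show "\<phi> (g \<otimes> h) i = \<phi> g (\<phi> h i)" if gh: "g \<in> carrier G" "h \<in> carrier G" and i: "i \<in> ?I" for g h i
    proof -
      have "\<phi> (g \<otimes> h) i = e' (\<alpha> g (\<alpha> h (e i)))"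
        using i mult[OF gh eX[OF i]] by (simp add: \<phi>_def)
      also have "\<dots> = \<phi> g (\<phi> h i)"
        by (simp only: \<phi>_def[of g "\<phi> h i"] in_I[OF gh(2) i] if_True eq[OF gh(2) i])
      finally show ?thesis .
    qed
  qed (auto simp: \<phi>_def one eX e'_e)
  then show thesis using that e eq by blast
qed

lemma (in group) normal_quotient_action:
  assumes "N \<lhd> G" and fin: "finite (rcosets N)"
  obtains \<phi> where "\<phi> \<in> hom G (sym_group (card (rcosets N)))"
    and "\<And>g x. g \<in> carrier G \<Longrightarrow> x \<in> {1..card (rcosets N)} \<Longrightarrow> \<phi> g x = x \<longleftrightarrow> g \<in> N"
    and "\<And>x y. x \<in> {1..card (rcosets N)} \<Longrightarrow> y \<in> {1..card (rcosets N)} \<Longrightarrow>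
      \<exists>g\<in>carrier G. \<phi> g x = y"
proof -
  interpret normal N G by fact
  interpret Q: group "G Mod N" by (rule factorgroup_is_group)
  have carr: "carrier (G Mod N) = rcosets N" by (simp add: FactGroup_def)
  have hom: "(\<lambda>g. N #> g) \<in> hom G (G Mod N)" by (rule r_coset_hom_Mod)
  have coset: "N #> g \<in> carrier (G Mod N)" if "g \<in> carrier G" for g
    using hom_in_carrier[OF hom that] .
  have N1: "N #> \<one> = \<one>\<^bsub>G Mod N\<^esub>" by (simp add: subset)
  let ?\<alpha> = "\<lambda>g C. (N #> g) \<otimes>\<^bsub>G Mod N\<^esub> C"
  have closed: "?\<alpha> g C \<in> rcosets N" if "g \<in> carrier G" "C \<in> rcosets N" for g C
    using that coset Q.m_closed unfolding carr[symmetric] by blast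
  have one: "?\<alpha> \<one> C = C" if "C \<in> rcosets N" for C
    unfolding N1 using that Q.l_one unfolding carr by blast
  have mult: "?\<alpha> (g \<otimes> h) C = ?\<alpha> g (?\<alpha> h C)"
    if "g \<in> carrier G" "h \<in> carrier G" "C \<in> rcosets N" for g h C
    unfolding hom_mult[OF hom that(1,2)] using that coset Q.m_assoc unfolding carr by blast
  obtain e \<phi> where e: "bij_betw e {1..card (rcosets N)} (rcosets N)"
    and \<phi>: "\<phi> \<in> hom G (sym_group (card (rcosets N)))"
    and eq: "\<And>g i. g \<in> carrier G \<Longrightarrow> i \<in> {1..card (rcosets N)} \<Longrightarrow> e (\<phi> g i) = ?\<alpha> g (e i)"
    by (rule finite_action_hom_sym_group[of "rcosets N" ?\<alpha>, OF fin closed one mult]) (assumption+, rule that)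
  have e_in: "e x \<in> carrier (G Mod N)" if "x \<in> {1..card (rcosets N)}" for x
    using bij_betwE[OF e] that carr by blast
  have in_range: "\<phi> g x \<in> {1..card (rcosets N)}"
    if "g \<in> carrier G" "x \<in> {1..card (rcosets N)}" for g x
    using permutes_in_image[OF sym_group_homD(1)[OF \<phi> that(1)]] that(2) by blast
  have inj: "e x = e y \<longleftrightarrow> x = y"
    if "x \<in> {1..card (rcosets N)}" "y \<in> {1..card (rcosets N)}" for x y
    using inj_on_eq_iff[OF bij_betw_imp_inj_on[OF e]] that .
  show thesis
  proof (rule that[OF \<phi>])
    fix g x assume g: "g \<in> carrier G" and x: "x \<in> {1..card (rcosets N)}"
    have "\<phi> g x = x \<longleftrightarrow> ?\<alpha> g (e x) = e x"
      using inj[OF in_range[OF g x] x] eq[OF g x] by simp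
    also have "\<dots> \<longleftrightarrow> N #> g = \<one>\<^bsub>G Mod N\<^esub>"
      using Q.r_cancel_one[OF e_in[OF x] coset[OF g]] by blast
    also have "\<dots> \<longleftrightarrow> g \<in> N"
      using coset_join1[OF _ g subgroup_axioms] coset_join2[OF g subgroup_axioms]
      unfolding one_FactGroup by blast
    finally show "\<phi> g x = x \<longleftrightarrow> g \<in> N" .
  next
    fix x y assume x: "x \<in> {1..card (rcosets N)}" and y: "y \<in> {1..card (rcosets N)}"
    have "e y \<otimes>\<^bsub>G Mod N\<^esub> inv\<^bsub>G Mod N\<^esub> e x \<in> carrier (G Mod N)"
      by (intro Q.m_closed Q.inv_closed e_in x y)
    then obtain g where g: "g \<in> carrier G" "N #> g = e y \<otimes>\<^bsub>G Mod N\<^esub> inv\<^bsub>G Mod N\<^esub> e x"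
      unfolding carrier_FactGroup by auto
    have "e (\<phi> g x) = e y"
      unfolding eq[OF g(1) x] g(2)
      by (simp only: Q.m_assoc[OF e_in[OF y] Q.inv_closed[OF e_in[OF x]] e_in[OF x]]
          Q.l_inv[OF e_in[OF x]] Q.r_one[OF e_in[OF y]])
    then show "\<exists>g\<in>carrier G. \<phi> g x = y"
      using g inj[OF in_range[OF g(1) x] y] by blast
  qed
qed

lemma (in group) replicated_action:
  assumes \<phi>: "\<phi> \<in> hom G (sym_group m)" and m: "m > 0"
  obtains \<psi> where "\<psi> \<in> hom G (sym_group n)"
    and "\<And>x. x \<in> {1..n div m * m} \<Longrightarrow>
      \<exists>y\<in>{1..m}. \<forall>g\<in>carrier G. \<psi> g x = x \<longleftrightarrow> \<phi> g y = y"
proof -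
  let ?q = "n div m"
  define b where "b x = Suc ((x - 1) mod m)" for x
  define d where "d x = (x - 1) div m" for x
  have decomp: "x = d x * m + b x" if "x \<ge> 1" for x
    using that by (simp add: d_def b_def)
  have b_in: "b x \<in> {1..m}" for x
    using m by (simp add: b_def Suc_leI)
  have d_less: "d x < ?q" if "x \<in> {1..?q * m}" for x
  proof -
    have "x - 1 < ?q * m" using that by auto
    then show ?thesis unfolding d_def by (rule less_mult_imp_div_less)
  qed
  have b_eq: "b (k * m + y) = y" "d (k * m + y) = k" if "y \<in> {1..m}" for k y
  proof -
    obtain y' where "y = Suc y'" "y' < m" using \<open>y \<in> {1..m}\<close> by (cases y) auto
    then show "b (k * m + y) = y" "d (k * m + y) = k" by (simp_all add: b_def d_def)
  qed
  have block: "k * m + y \<in> {1..?q * m}" if "k < ?q" "y \<in> {1..m}" for k y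
  proof -
    have "k * m + y \<le> Suc k * m" using that by simp
    also have "\<dots> \<le> ?q * m" using that by (intro mult_right_mono) auto
    finally show ?thesis using that by simp
  qed
  have \<phi>_in: "\<phi> g y \<in> {1..m}" if "g \<in> carrier G" "y \<in> {1..m}" for g y
    using permutes_in_image[OF sym_group_homD(1)[OF \<phi> that(1)]] that(2) by simp
  define \<psi> where "\<psi> g x = (if x \<in> {1..?q * m} then d x * m + \<phi> g (b x) else x)" for g x
  have \<psi>_block: "\<psi> g x = d x * m + \<phi> g (b x)" if "x \<in> {1..?q * m}" for g x
    unfolding \<psi>_def using that by (rule if_P)
  have \<psi>_outside: "\<psi> g x = x" if "x \<notin> {1..?q * m}" for g x
    unfolding \<psi>_def using that by (rule if_not_P)
  have \<psi>_in: "\<psi> g x \<in> {1..?q * m}" if "g \<in> carrier G" "x \<in> {1..?q * m}" for g x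
    unfolding \<psi>_block[OF that(2)] using block[OF d_less \<phi>_in[OF _ b_in]] that by blast
  have le: "?q * m \<le> n" by simp
  have "\<psi> \<in> hom G (sym_group n)"
  proof (rule hom_sym_groupI)
    show "\<psi> g x \<in> {1..n}" if "g \<in> carrier G" "x \<in> {1..n}" for g x
    proof (cases "x \<in> {1..?q * m}")
      case True
      then show ?thesis using \<psi>_in[OF that(1) True] le by (meson atLeastAtMost_iff order_trans)
    next
      case False
      then show ?thesis using that \<psi>_outside by simp
    qed
    show "\<psi> g x = x" if "x \<notin> {1..n}" for g x
      using that le \<psi>_outside by (meson atLeastAtMost_iff order_trans)
    show "\<psi> \<one> x = x" for x
      using decomp[of x] by (simp add: \<psi>_def sym_group_homD(3)[OF \<phi> group_axioms])
    show "\<psi> (g \<otimes> h) x = \<psi> g (\<psi> h x)" if g: "g \<in> carrier G" and h: "h \<in> carrier G" for g h x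
    proof (cases "x \<in> {1..?q * m}")
      case True
      have "\<psi> g (\<psi> h x) = d (\<psi> h x) * m + \<phi> g (b (\<psi> h x))"
        by (rule \<psi>_block[OF \<psi>_in[OF h True]])
      also have "\<dots> = d x * m + \<phi> g (\<phi> h (b x))"
        by (simp only: \<psi>_block[OF True] b_eq[OF \<phi>_in[OF h b_in]])
      also have "\<dots> = \<psi> (g \<otimes> h) x"
        by (simp only: \<psi>_block[OF True] sym_group_homD(2)[OF \<phi> g h])
      finally show ?thesis by (rule sym)
    next
      case False
      then show ?thesis by (simp only: \<psi>_outside if_False not_False_eq_True)
    qed
  qed
  moreover have "\<exists>y\<in>{1..m}. \<forall>g\<in>carrier G. \<psi> g x = x \<longleftrightarrow> \<phi> g y = y" if x: "x \<in> {1..?q * m}" for x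
  proof (intro bexI[OF _ b_in[of x]] ballI)
    fix g
    have "\<psi> g x = d x * m + \<phi> g (b x)" by (rule \<psi>_block[OF x])
    moreover have "x = d x * m + b x" using x decomp by simp
    ultimately show "\<psi> g x = x \<longleftrightarrow> \<phi> g (b x) = b x" by linarith
  qed
  ultimately show thesis using that by blast
qed

section \<open>Finite-index subgroups\<close>

lemma (in group) finite_index_kernel:
  assumes \<phi>: "\<phi> \<in> hom G (sym_group n)"
  shows "kernel G (sym_group n) \<phi> \<lhd> G" and "finite (rcosets (kernel G (sym_group n) \<phi>))"
proof -
  interpret group_hom G "sym_group n" \<phi>
    using assms sym_group_is_group by (simp add: group_hom_def group_hom_axioms_def)
  show "kernel G (sym_group n) \<phi> \<lhd> G" by (rule normal_kernel)
  have "finite (carrier (sym_group n))"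
    using finite_permutations[of "{1..n}"] by (simp add: sym_group_def)
  then have "finite (carrier (G Mod kernel G (sym_group n) \<phi>))"
    using FactGroup_the_elem_mem by (intro inj_on_finite[OF FactGroup_inj_on]) auto
  then show "finite (rcosets (kernel G (sym_group n) \<phi>))" by (simp add: FactGroup_def)
qed

text \<open>\<open>N\<close> is the kernel of the action on pairs of cosets.\<close>

lemma (in group) finite_index_normal_below:
  assumes H: "subgroup H G" "finite (rcosets H)" and K: "subgroup K G" "finite (rcosets K)"
  obtains N where "N \<lhd> G" and "finite (rcosets N)" and "N \<subseteq> H \<inter> K"
proof -
  let ?\<alpha> = "\<lambda>g (C, D). (C #> inv g, D #> inv g)"
  have sub: "C \<subseteq> carrier G" if "subgroup L G" "C \<in> rcosets L" for C L
    using subgroup.rcosets_carrier[OF that(1) group_axioms that(2)] .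
  have coset_mult: "C #> g \<in> rcosets L" if "subgroup L G" "C \<in> rcosets L" "g \<in> carrier G" for C L g
    using that subgroup.subset[OF that(1)]
    by (auto simp: RCOSETS_def coset_mult_assoc)
  let ?X = "(rcosets H) \<times> (rcosets K)"
  have fin: "finite ?X" using H K by simp
  have closed: "?\<alpha> g x \<in> ?X" if "g \<in> carrier G" "x \<in> ?X" for g x
    using that coset_mult H K by auto
  have one: "?\<alpha> \<one> x = x" if "x \<in> ?X" for x
    using that sub[OF H(1)] sub[OF K(1)] by auto
  have mult: "?\<alpha> (g \<otimes> h) x = ?\<alpha> g (?\<alpha> h x)"
    if "g \<in> carrier G" "h \<in> carrier G" "x \<in> ?X" for g h x
    using that sub[OF H(1)] sub[OF K(1)] by (auto simp: coset_mult_assoc inv_mult_group)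
  obtain e \<phi> where e: "bij_betw e {1..card ?X} ?X"
    and \<phi>: "\<phi> \<in> hom G (sym_group (card ?X))"
    and eq: "\<And>g i. g \<in> carrier G \<Longrightarrow> i \<in> {1..card ?X} \<Longrightarrow> e (\<phi> g i) = ?\<alpha> g (e i)"
    by (rule finite_action_hom_sym_group[of ?X ?\<alpha>, OF fin closed one mult]) (assumption+, rule that)
  let ?N = "kernel G (sym_group (card (?X))) \<phi>"
  have "?N \<subseteq> H \<inter> K"
  proof
    fix g assume "g \<in> ?N"
    then have g: "g \<in> carrier G" "\<phi> g = id" by (auto simp: kernel_def sym_group_one)
    have "(H, K) \<in> e ` {1..card ?X}"
      unfolding bij_betw_imp_surj_on[OF e]
      using subgroup.subgroup_in_rcosets[OF H(1) group_axioms]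
        subgroup.subgroup_in_rcosets[OF K(1) group_axioms] by (rule SigmaI)
    then obtain i where i: "(H, K) = e i" "i \<in> {1..card ?X}" by (rule imageE)
    have "(H, K) = (H #> inv g, K #> inv g)"
      using eq[OF g(1) i(2)] unfolding i(1)[symmetric] g(2) id_apply case_prod_conv .
    then have coset: "H = H #> inv g" "K = K #> inv g" by (blast elim: Pair_inject)+
    have "inv g \<in> H" "inv g \<in> K"
      by (rule coset_join1[OF coset(1)[symmetric] inv_closed[OF g(1)] H(1)],
          rule coset_join1[OF coset(2)[symmetric] inv_closed[OF g(1)] K(1)])
    then show "g \<in> H \<inter> K"
      using subgroup.m_inv_closed[OF H(1)] subgroup.m_inv_closed[OF K(1)] inv_inv[OF g(1)] by force
  qed
  then show thesis using that finite_index_kernel[OF \<phi>] by blast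
qed

lemma (in group) finite_overgroups:
  assumes K: "subgroup K G" and fin: "finite (rcosets K)"
  shows "finite {H. subgroup H G \<and> K \<subseteq> H}"
proof (rule inj_on_finite)
  show "inj_on (\<lambda>H. {C \<in> rcosets K. C \<subseteq> H}) {H. subgroup H G \<and> K \<subseteq> H}"
  proof (rule inj_on_inverseI[where g = Union], rule equalityI)
    fix H assume "H \<in> {H. subgroup H G \<and> K \<subseteq> H}"
    then have H: "subgroup H G" "K \<subseteq> H" by auto
    show "H \<subseteq> \<Union> {C \<in> rcosets K. C \<subseteq> H}"
    proof
      fix h assume h: "h \<in> H"
      have hG: "h \<in> carrier G" using subgroup.mem_carrier[OF H(1) h] .
      have "K #> h \<subseteq> H"
        using subgroup.m_closed[OF H(1) _ h] H(2) by (auto simp: r_coset_def)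
      moreover have "h \<in> K #> h" using rcos_self[OF hG K] .
      moreover have "K #> h \<in> rcosets K" using hG by (auto simp: RCOSETS_def)
      ultimately show "h \<in> \<Union> {C \<in> rcosets K. C \<subseteq> H}" by blast
    qed
  qed blast
  show "(\<lambda>H. {C \<in> rcosets K. C \<subseteq> H}) ` {H. subgroup H G \<and> K \<subseteq> H} \<subseteq> Pow (rcosets K)"
    by blast
qed (use fin in simp)

lemma (in group) card_rcosets_strict_antimono:
  assumes N: "subgroup N G" "finite (rcosets N)" and K: "subgroup K G" and "N \<subset> K"
  shows "card (rcosets K) < card (rcosets N)"
proof -
  have KN: "K <#> (N #> g) = K #> g" if g: "g \<in> carrier G" for g
  proof -
    have "K <#> N = K"
    proof
      show "K <#> N \<subseteq> K"
        using \<open>N \<subset> K\<close> subgroup.m_closed[OF K] by (auto simp: set_mult_def)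
      show "K \<subseteq> K <#> N"
      proof
        fix k assume "k \<in> K"
        moreover from this have "k = k \<otimes> \<one>" using subgroup.mem_carrier[OF K] by simp
        ultimately show "k \<in> K <#> N"
          using subgroup.one_closed[OF N(1)] unfolding set_mult_def by blast
      qed
    qed
    then show ?thesis
      using g setmult_rcos_assoc[OF subgroup.subset[OF K] subgroup.subset[OF N(1)] g] by simp
  qed
  have img: "(\<lambda>C. K <#> C) ` (rcosets N) = rcosets K"
    using KN by (force simp: RCOSETS_def)
  obtain g where g: "g \<in> K" "g \<notin> N" using \<open>N \<subset> K\<close> by blast
  have gG: "g \<in> carrier G" using subgroup.mem_carrier[OF K g(1)] .
  have "\<not> inj_on (\<lambda>C. K <#> C) (rcosets N)"
  proof
    assume inj: "inj_on (\<lambda>C. K <#> C) (rcosets N)"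
    have "K <#> (N #> g) = K <#> (N #> \<one>)"
      using KN[OF gG] KN[OF one_closed] coset_join2[OF gG K g(1)] subgroup.subset[OF K] by simp
    then have "N #> g = N #> \<one>"
      using inj gG by (auto simp: inj_on_def RCOSETS_def)
    then have "N #> g = N" using subgroup.subset[OF N(1)] by simp
    then show False using coset_join1[OF _ gG N(1)] g by blast
  qed
  then have "card (rcosets K) \<noteq> card (rcosets N)"
    using eq_card_imp_inj_on[OF N(2), of "\<lambda>C. K <#> C"] unfolding img by metis
  moreover have "card (rcosets K) \<le> card (rcosets N)"
    using card_image_le[OF N(2), of "\<lambda>C. K <#> C"] unfolding img .
  ultimately show ?thesis by simp
qed

lemma (in group) finite_index_normal_chain:
  assumes inf: "infinite {H. subgroup H G \<and> finite (rcosets H)}"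
  obtains K :: "nat \<Rightarrow> 'a set" where "\<And>i. K i \<lhd> G" and "\<And>i. finite (rcosets (K i))"
    and "\<And>i. K (Suc i) \<subset> K i"
proof -
  have step: "\<exists>N. (N \<lhd> G \<and> finite (rcosets N)) \<and> N \<subset> K" if K: "K \<lhd> G \<and> finite (rcosets K)" for K
  proof -
    have sub: "subgroup K G" using normal_imp_subgroup[OF conjunct1[OF K]] .
    have "\<not> {H. subgroup H G \<and> finite (rcosets H)} \<subseteq> {H. subgroup H G \<and> K \<subseteq> H}"
      using inf finite_overgroups[OF sub] K finite_subset by blast
    then obtain H where "subgroup H G" "finite (rcosets H)" "\<not> K \<subseteq> H" by auto
    moreover obtain N where "N \<lhd> G" "finite (rcosets N)" "N \<subseteq> H \<inter> K"
      using finite_index_normal_below[OF \<open>subgroup H G\<close> \<open>finite (rcosets H)\<close> sub] K by blast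
    ultimately show ?thesis by blast
  qed
  obtain H where H: "subgroup H G" "finite (rcosets H)"
    using inf not_finite_existsD by blast
  have "\<exists>N. N \<lhd> G \<and> finite (rcosets N)"
    using finite_index_normal_below[OF H H] by blast
  then have "\<exists>K. \<forall>i. (K i \<lhd> G \<and> finite (rcosets (K i))) \<and> K (Suc i) \<subset> K i"
    using step by (intro dependent_nat_choice[of "\<lambda>i N. N \<lhd> G \<and> finite (rcosets N)" "\<lambda>i N N'. N' \<subset> N"])
  then obtain K where K: "\<forall>i. (K i \<lhd> G \<and> finite (rcosets (K i))) \<and> K (Suc i) \<subset> K i"
    by (rule exE)
  show thesis by (rule that[of K]) (use K in simp_all)
qed

lemma (in group) residually_finite_infinite_finite_index:
  assumes inf: "infinite (carrier G)"
    and rf: "\<And>g. g \<in> carrier G \<Longrightarrow> g \<noteq> \<one> \<Longrightarrow> \<exists>H. subgroup H G \<and> finite (rcosets H) \<and> g \<notin> H"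
  shows "infinite {H. subgroup H G \<and> finite (rcosets H)}" (is "infinite ?F")
proof
  assume "finite ?F"
  obtain g where "g \<in> carrier G" "g \<noteq> \<one>"
    using inf finite_subset[of "carrier G" "{\<one>}"] by blast
  then have "?F \<noteq> {}" using rf by blast
  then obtain N where NF: "N \<in> ?F" and minimal: "\<forall>H\<in>?F. H \<subseteq> N \<longrightarrow> N = H"
    using finite_has_minimal[OF \<open>finite ?F\<close>] by meson
  have N: "subgroup N G" "finite (rcosets N)" using NF by simp_all
  have "g = \<one>" if g: "g \<in> N" for g
  proof (rule ccontr)
    assume "g \<noteq> \<one>"
    then obtain H where H: "subgroup H G" "finite (rcosets H)" "g \<notin> H"
      using rf subgroup.mem_carrier[OF N(1) g] by blast
    obtain M where "M \<lhd> G" "finite (rcosets M)" "M \<subseteq> N \<inter> H"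
      using finite_index_normal_below[OF N H(1,2)] .
    with bspec[OF minimal, of M] H(3) g show False by (simp add: normal_imp_subgroup) blast
  qed
  then have "N \<subseteq> {\<one>}" by blast
  then have "finite N" by (rule finite_subset) simp
  then have "finite C" if "C \<in> rcosets N" for C
    using that by (auto simp: RCOSETS_def r_coset_def)
  then have "finite (\<Union> (rcosets N))" using N(2) by blast
  then show False
    using inf rcosets_part_G[OF N(1)] by simp
qed

section \<open>Permutation representations and property tau\<close>

definition perm_matrix :: "nat \<Rightarrow> (nat \<Rightarrow> nat) \<Rightarrow> complex mat" where
  "perm_matrix n p = mat n n (\<lambda>(i, j). of_bool (p (Suc j) = Suc i))"

definition fun_vec :: "nat \<Rightarrow> (nat \<Rightarrow> complex) \<Rightarrow> complex vec" where
  "fun_vec n u = vec n (\<lambda>i. u (Suc i))"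

lemma perm_matrix_carrier [simp]: "perm_matrix n p \<in> carrier_mat n n"
  by (simp add: perm_matrix_def)

lemma fun_vec_carrier [simp]: "fun_vec n u \<in> carrier_vec n"
  by (simp add: fun_vec_def)

lemma fun_vec_surj:
  assumes "v \<in> carrier_vec n"
  shows "v = fun_vec n (\<lambda>x. v $ (x - 1))"
  using assms by (auto simp: fun_vec_def)

lemma fun_vec_eq_iff: "fun_vec n u = fun_vec n w \<longleftrightarrow> (\<forall>x\<in>{1..n}. u x = w x)"
proof -
  have "(\<forall>i<n. u (Suc i) = w (Suc i)) \<longleftrightarrow> (\<forall>x\<in>Suc ` {..<n}. u x = w x)"
    by auto
  also have "Suc ` {..<n} = {1..n}"
    by (simp add: image_Suc_lessThan)
  finally show ?thesis
    by (simp add: fun_vec_def vec_eq_iff)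
qed

lemma fun_vec_minus: "fun_vec n u - fun_vec n w = fun_vec n (\<lambda>x. u x - w x)"
  by (auto simp: fun_vec_def)

lemma fun_vec_cscalar_prod: "fun_vec n u \<bullet>c fun_vec n w = (\<Sum>x\<in>{1..n}. u x * cnj (w x))"
proof -
  have "(\<Sum>x\<in>{1..n}. u x * cnj (w x)) = (\<Sum>x\<in>Suc ` {0..<n}. u x * cnj (w x))"
    by (simp add: image_Suc_atLeastLessThan atLeastLessThanSuc_atLeastAtMost)
  also have "\<dots> = (\<Sum>i = 0..<n. u (Suc i) * cnj (w (Suc i)))"
    by (subst sum.reindex) simp_all
  finally show ?thesis
    by (simp add: fun_vec_def scalar_prod_def)
qed

lemma cvec_norm_fun_vec: "(cvec_norm (fun_vec n u))\<^sup>2 = (\<Sum>x\<in>{1..n}. (cmod (u x))\<^sup>2)"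
  by (simp add: cvec_norm_def fun_vec_cscalar_prod sum_nonneg flip: complex_norm_square)

lemma perm_matrix_mult_fun_vec:
  assumes p: "p permutes {1..n}"
  shows "perm_matrix n p *\<^sub>v fun_vec n u = fun_vec n (u \<circ> inv' p)"
proof (rule eq_vecI)
  fix i assume "i < dim_vec (fun_vec n (u \<circ> inv' p))"
  then have i: "i < n" by (simp add: fun_vec_def)
  have "inv' p (Suc i) \<in> {1..n}"
    using i permutes_in_image[OF permutes_inv[OF p]] by simp
  then obtain k where k: "k < n" "inv' p (Suc i) = Suc k"
    by (cases "inv' p (Suc i)") auto
  have eq: "p (Suc j) = Suc i \<longleftrightarrow> j = k" for j
    using k permutes_inverses[OF p] by (metis Suc_inject)
  have "(perm_matrix n p *\<^sub>v fun_vec n u) $ i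
      = (\<Sum>j = 0..<n. of_bool (p (Suc j) = Suc i) * u (Suc j))"
    using i by (simp add: perm_matrix_def fun_vec_def scalar_prod_def)
  also have "\<dots> = (\<Sum>j = 0..<n. if j = k then u (Suc j) else 0)"
    by (rule sum.cong) (auto simp: eq)
  also have "\<dots> = fun_vec n (u \<circ> inv' p) $ i"
    using k i by (simp add: fun_vec_def)
  finally show "(perm_matrix n p *\<^sub>v fun_vec n u) $ i = fun_vec n (u \<circ> inv' p) $ i" .
qed (simp add: perm_matrix_def fun_vec_def)

lemma perm_matrix_id [simp]: "perm_matrix n id = 1\<^sub>m n"
  by (rule eq_matI) (auto simp: perm_matrix_def)

lemma perm_matrix_compose:
  assumes q: "q permutes {1..n}"
  shows "perm_matrix n (p \<circ> q) = perm_matrix n p * perm_matrix n q"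
proof (rule eq_matI)
  fix i j assume "i < dim_row (perm_matrix n p * perm_matrix n q)"
    "j < dim_col (perm_matrix n p * perm_matrix n q)"
  then have ij: "i < n" "j < n" by (simp_all add: perm_matrix_def)
  have "q (Suc j) \<in> {1..n}"
    using ij permutes_in_image[OF q] by simp
  then obtain k where k: "k < n" "q (Suc j) = Suc k"
    by (cases "q (Suc j)") auto
  have "(perm_matrix n p * perm_matrix n q) $$ (i, j)
      = (\<Sum>l = 0..<n. of_bool (p (Suc l) = Suc i) * of_bool (q (Suc j) = Suc l))"
    using ij by (simp add: perm_matrix_def scalar_prod_def)
  also have "\<dots> = (\<Sum>l = 0..<n. if l = k then of_bool (p (Suc l) = Suc i) else 0)"
    by (rule sum.cong) (auto simp: k)
  also have "\<dots> = perm_matrix n (p \<circ> q) $$ (i, j)"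
    using k ij by (simp add: perm_matrix_def)
  finally show "perm_matrix n (p \<circ> q) $$ (i, j) = (perm_matrix n p * perm_matrix n q) $$ (i, j)"
    by simp
qed (simp_all add: perm_matrix_def)

lemma mat_adjoint_perm_matrix:
  assumes p: "p permutes {1..n}"
  shows "mat_adjoint (perm_matrix n p) = perm_matrix n (inv' p)"
proof (rule eq_matI)
  fix i j assume "i < dim_row (perm_matrix n (inv' p))" "j < dim_col (perm_matrix n (inv' p))"
  then have ij: "i < n" "j < n" by (simp_all add: perm_matrix_def)
  have "p (Suc i) = Suc j \<longleftrightarrow> inv' p (Suc j) = Suc i"
    using permutes_inverses[OF p] by metis
  then show "mat_adjoint (perm_matrix n p) $$ (i, j) = perm_matrix n (inv' p) $$ (i, j)"
    using ij by (simp add: mat_adjoint_def perm_matrix_def mat_of_rows_def)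
qed (simp_all add: perm_matrix_def mat_adjoint_def)

lemma perm_matrix_hom: "perm_matrix n \<in> hom (sym_group n) (unitary_group n)"
proof (rule homI)
  fix p assume "p \<in> carrier (sym_group n)"
  then have p: "p permutes {1..n}" by (simp add: sym_group_carrier)
  then show "perm_matrix n p \<in> carrier (unitary_group n)"
    using permutes_inv[OF p] permutes_inv_o[OF p]
    by (simp add: unitary_group_def mat_adjoint_perm_matrix perm_matrix_compose[symmetric])
next
  fix p q assume "q \<in> carrier (sym_group n)"
  then show "perm_matrix n (p \<otimes>\<^bsub>sym_group n\<^esub> q)
      = perm_matrix n p \<otimes>\<^bsub>unitary_group n\<^esub> perm_matrix n q"
    by (simp add: sym_group_def unitary_group_def perm_matrix_compose)
qed

lemma factors_through_finite_quotient_perm_matrix: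
  assumes "group G" and \<phi>: "\<phi> \<in> hom G (sym_group n)"
  shows "factors_through_finite_quotient G n (perm_matrix n \<circ> \<phi>)"
proof -
  interpret group_hom G "sym_group n" \<phi>
    using assms sym_group_is_group by (simp add: group_hom_def group_hom_axioms_def)
  let ?N = "kernel G (sym_group n) \<phi>"
  obtain \<psi> where \<psi>: "\<psi> \<in> hom (G Mod ?N) (sym_group n)"
      "\<And>x. x \<in> carrier G \<Longrightarrow> \<psi> (?N #>\<^bsub>G\<^esub> x) = \<phi> x"
    using FactGroup_universal_kernel[OF normal_kernel order_refl] by blast
  have "finite (carrier (G Mod ?N))"
    using G.finite_index_kernel(2)[OF \<phi>] by (simp add: FactGroup_def)
  moreover have "perm_matrix n \<circ> \<psi> \<in> hom (G Mod ?N) (unitary_group n)"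
    using Group.hom_compose[OF \<psi>(1) perm_matrix_hom] .
  ultimately show ?thesis
    unfolding factors_through_finite_quotient_def
    using normal_kernel \<psi>(2) by (intro exI[of _ ?N]) (auto intro!: bexI[of _ "perm_matrix n \<circ> \<psi>"])
qed

lemma fun_vec_in_invariant_vectors:
  assumes \<phi>: "\<phi> \<in> hom G (sym_group n)"
  shows "fun_vec n u \<in> invariant_vectors G n (perm_matrix n \<circ> \<phi>) \<longleftrightarrow>
    (\<forall>g\<in>carrier G. \<forall>x\<in>{1..n}. u (\<phi> g x) = u x)"
proof -
  have "perm_matrix n (\<phi> g) *\<^sub>v fun_vec n u = fun_vec n u \<longleftrightarrow> (\<forall>x\<in>{1..n}. u (\<phi> g x) = u x)"
    if "g \<in> carrier G" for g
  proof -
    have p: "\<phi> g permutes {1..n}"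
      using hom_in_carrier[OF \<phi> that] by (simp add: sym_group_carrier)
    show ?thesis
      unfolding perm_matrix_mult_fun_vec[OF p] fun_vec_eq_iff o_def
      using permutes_in_image[OF p] permutes_in_image[OF permutes_inv[OF p]] permutes_inverses[OF p]
      by metis
  qed
  then show ?thesis
    by (simp add: invariant_vectors_def)
qed

lemma orth_projection_eqI:
  assumes W: "W \<subseteq> carrier_vec n" and diff: "\<And>u w. u \<in> W \<Longrightarrow> w \<in> W \<Longrightarrow> u - w \<in> W"
    and v: "v \<in> carrier_vec n" and w: "w \<in> W" and orth: "\<And>u. u \<in> W \<Longrightarrow> (v - w) \<bullet>c u = 0"
  shows "orth_projection W v = w"
  unfolding orth_projection_def
proof (rule the_equality)
  fix w' assume w': "w' \<in> W \<and> (\<forall>u\<in>W. (v - w') \<bullet>c u = 0)"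
  let ?d = "w - w'"
  have carr: "w \<in> carrier_vec n" "w' \<in> carrier_vec n" and d: "?d \<in> W"
    using W w w' diff by auto
  have cd: "conjugate ?d \<in> carrier_vec n" using carr by simp
  have "?d = (v - w') - (v - w)"
    using carr v by (intro eq_vecI) auto
  then have "?d \<bullet>c ?d = ((v - w') - (v - w)) \<bullet>c ?d" by simp
  also have "\<dots> = (v - w') \<bullet>c ?d - (v - w) \<bullet>c ?d"
    using carr v cd by (intro minus_scalar_prod_distrib[of _ n]) auto
  also have "\<dots> = 0" using w' d orth by simp
  finally have "?d \<bullet>c ?d = 0" .
  then have "?d = 0\<^sub>v n"
    using carr conjugate_square_eq_0_vec[of ?d n] by simp
  then have "\<forall>i<n. w $ i - w' $ i = 0"
    using carr by (metis index_minus_vec(1) index_zero_vec(1) carrier_vecD)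
  then show "w' = w"
    using carr by (intro eq_vecI) auto
qed (use w orth in auto)

text \<open>The projection onto the invariant vectors is averaging over the image of the group; it is
  compared with the indicator function of \<open>D\<close>, which is almost invariant.\<close>

lemma property_tau_almost_invariant_subset:
  assumes "group G" and "S \<subseteq> carrier G" and "property_tau G S"
  obtains \<delta> :: real where "\<delta> > 0"
    and "\<And>n \<phi> D. \<phi> \<in> hom G (sym_group n) \<Longrightarrow> D \<subseteq> {1..n} \<Longrightarrow> D \<noteq> {} \<Longrightarrow>
      (\<And>s. s \<in> S \<Longrightarrow> card {x \<in> D. \<phi> s x \<notin> D} \<le> \<delta> * card D) \<Longrightarrow>
      \<exists>x\<in>D. card (\<phi> ` carrier G) < 2 * card {p \<in> \<phi> ` carrier G. p x \<in> D}"
proof -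
  interpret group G by fact
  obtain \<kappa> :: real where \<kappa>: "\<kappa> > 0"
    and tau: "\<And>n \<rho> v \<epsilon>. \<rho> \<in> hom G (unitary_group n) \<Longrightarrow> factors_through_finite_quotient G n \<rho> \<Longrightarrow>
      v \<in> carrier_vec n \<Longrightarrow> \<epsilon> > 0 \<Longrightarrow>
      (\<And>s. s \<in> S \<Longrightarrow> cvec_norm (\<rho> s *\<^sub>v v - v) \<le> \<epsilon> * cvec_norm v) \<Longrightarrow>
      cvec_norm (v - orth_projection (invariant_vectors G n \<rho>) v) \<le> \<epsilon> / \<kappa> * cvec_norm v"
    using assms(3) unfolding property_tau_def by blast
  define \<delta> where "\<delta> = \<kappa>\<^sup>2 / 32"
  have norm_nonneg: "cvec_norm v \<ge> 0" if "v \<in> carrier_vec n" for v n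
    using that conjugate_square_ge_0_vec[of v] by (simp add: cvec_norm_def less_eq_complex_def)
  show thesis
  proof (rule that)
    show "\<delta> > 0" using \<kappa> by (simp add: \<delta>_def)
    fix n \<phi> D
    assume \<phi>: "\<phi> \<in> hom G (sym_group n)" and D: "D \<subseteq> {1..n}" "D \<noteq> {}"
      and small: "\<And>s. s \<in> S \<Longrightarrow> card {x \<in> D. \<phi> s x \<notin> D} \<le> \<delta> * card D"
    let ?A = "\<phi> ` carrier G"
    let ?\<rho> = "perm_matrix n \<circ> \<phi>"
    have perm: "\<phi> g permutes {1..n}" if "g \<in> carrier G" for g
      using hom_in_carrier[OF \<phi> that] by (simp add: sym_group_carrier)
    have mult: "\<phi> (g \<otimes>\<^bsub>G\<^esub> h) = \<phi> g \<circ> \<phi> h" if "g \<in> carrier G" "h \<in> carrier G" for g h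
      using hom_mult[OF \<phi> that] by (simp add: sym_group_mult)
    have finD: "finite D" using D finite_subset by blast
    have cardD: "card D > 0" using D finD by (simp add: card_gt_0_iff)
    have finA: "finite ?A"
      using perm by (intro finite_subset[OF _ finite_permutations[of "{1..n}"]]) auto
    have cardA: "card ?A > 0"
      using finA one_closed by (auto simp: card_gt_0_iff)
    have reindex: "(\<Sum>p\<in>?A. F (p \<circ> \<phi> g)) = (\<Sum>p\<in>?A. F p)"
      if g: "g \<in> carrier G" for F :: "_ \<Rightarrow> complex" and g
    proof (rule sum.reindex_bij_witness[of _ "\<lambda>p. p \<circ> \<phi> (inv\<^bsub>G\<^esub> g)" "\<lambda>p. p \<circ> \<phi> g"])
      have inv: "\<phi> g \<circ> \<phi> (inv\<^bsub>G\<^esub> g) = id" "\<phi> (inv\<^bsub>G\<^esub> g) \<circ> \<phi> g = id"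
        using g mult[symmetric] hom_one[OF \<phi> group_axioms sym_group_is_group]
        by (simp_all add: sym_group_one)
      show "p \<circ> \<phi> g \<circ> \<phi> (inv\<^bsub>G\<^esub> g) = p" "p \<circ> \<phi> (inv\<^bsub>G\<^esub> g) \<circ> \<phi> g = p" for p
        using inv by (simp_all add: comp_assoc)
      show "p \<circ> \<phi> g \<in> ?A" "p \<circ> \<phi> (inv\<^bsub>G\<^esub> g) \<in> ?A" if "p \<in> ?A" for p
        using that g mult[symmetric] by auto
    qed auto
    define u :: "nat \<Rightarrow> complex" where "u = (\<lambda>x. of_bool (x \<in> D))"
    define w where "w = (\<lambda>x. (\<Sum>p\<in>?A. u (p x)) / card ?A)"
    have "fun_vec n w \<in> invariant_vectors G n ?\<rho>"
      unfolding fun_vec_in_invariant_vectors[OF \<phi>] w_def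
      using reindex[of _ "\<lambda>p. u (p x)" for x] by simp
    moreover have "(fun_vec n u - fun_vec n w) \<bullet>c z = 0" if z: "z \<in> invariant_vectors G n ?\<rho>" for z
    proof -
      define y where "y x = z $ (x - 1)" for x
      have zy: "z = fun_vec n y"
        using z fun_vec_surj unfolding y_def invariant_vectors_def by blast
      then have y: "y (\<phi> g x) = y x" if "g \<in> carrier G" "x \<in> {1..n}" for g x
        using z that unfolding zy fun_vec_in_invariant_vectors[OF \<phi>] by blast
      have "(\<Sum>x\<in>{1..n}. (\<Sum>p\<in>?A. u (p x)) * cnj (y x))
          = (\<Sum>p\<in>?A. \<Sum>x\<in>{1..n}. u (p x) * cnj (y x))"
        by (simp add: sum_distrib_right sum.swap[of _ ?A])
      also have "\<dots> = (\<Sum>p\<in>?A. \<Sum>x\<in>{1..n}. u x * cnj (y x))"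
      proof (rule sum.cong[OF refl])
        fix p assume "p \<in> ?A"
        then obtain g where g: "g \<in> carrier G" "p = \<phi> g" by auto
        have "(\<Sum>x\<in>{1..n}. u (p x) * cnj (y x)) = (\<Sum>x\<in>{1..n}. u (p x) * cnj (y (p x)))"
          using g y by simp
        also have "\<dots> = (\<Sum>x\<in>{1..n}. u x * cnj (y x))"
          using sum.permute[OF perm[OF g(1)], of "\<lambda>x. u x * cnj (y x)"] g by (simp add: o_def)
        finally show "(\<Sum>x\<in>{1..n}. u (p x) * cnj (y x)) = (\<Sum>x\<in>{1..n}. u x * cnj (y x))" .
      qed
      finally have "(\<Sum>x\<in>{1..n}. w x * cnj (y x)) = (\<Sum>x\<in>{1..n}. u x * cnj (y x))"
        using cardA by (simp add: w_def flip: sum_divide_distrib)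
      then show ?thesis
        unfolding zy fun_vec_minus fun_vec_cscalar_prod
        by (simp add: left_diff_distrib sum_subtractf)
    qed
    moreover have "a - b \<in> invariant_vectors G n ?\<rho>"
      if "a \<in> invariant_vectors G n ?\<rho>" "b \<in> invariant_vectors G n ?\<rho>" for a b
      using that unfolding invariant_vectors_def
      by (auto simp: mult_minus_distrib_mat_vec[of _ n n])
    ultimately have proj: "orth_projection (invariant_vectors G n ?\<rho>) (fun_vec n u) = fun_vec n w"
      by (intro orth_projection_eqI[of _ n]) (auto simp: invariant_vectors_def)
    have norm_u: "(cvec_norm (fun_vec n u))\<^sup>2 = card D"
    proof -
      have "(\<Sum>x\<in>{1..n}. (cmod (u x))\<^sup>2) = (\<Sum>x\<in>{1..n}. if x \<in> D then 1 else 0)"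
        by (rule sum.cong) (auto simp: u_def)
      then show ?thesis
        using D by (simp add: cvec_norm_fun_vec sum.If_cases Int_absorb1)
    qed
    have "cvec_norm (?\<rho> s *\<^sub>v fun_vec n u - fun_vec n u) \<le> \<kappa> / 4 * cvec_norm (fun_vec n u)"
      if s: "s \<in> S" for s
    proof (rule power2_le_imp_le)
      have p: "\<phi> s permutes {1..n}" using perm s assms(2) by auto
      have "(cvec_norm (?\<rho> s *\<^sub>v fun_vec n u - fun_vec n u))\<^sup>2
          = (\<Sum>x\<in>{1..n}. (cmod (u (inv' (\<phi> s) x) - u x))\<^sup>2)"
        by (simp add: perm_matrix_mult_fun_vec[OF p] fun_vec_minus cvec_norm_fun_vec)
      also have "\<dots> = (\<Sum>x\<in>{1..n}. (cmod (u x - u (\<phi> s x)))\<^sup>2)"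
        using sum.permute[OF p, of "\<lambda>x. (cmod (u (inv' (\<phi> s) x) - u x))\<^sup>2"] permutes_inverses[OF p]
        by (simp add: o_def)
      also have "\<dots> = (\<Sum>x\<in>{1..n}. of_bool (x \<in> D \<and> \<phi> s x \<notin> D) + of_bool (x \<notin> D \<and> \<phi> s x \<in> D))"
        by (rule sum.cong) (auto simp: u_def)
      also have "\<dots> = real (card {x \<in> {1..n}. x \<in> D \<and> \<phi> s x \<notin> D})
          + real (card {x \<in> {1..n}. x \<notin> D \<and> \<phi> s x \<in> D})"
        by (simp add: sum.distrib of_bool_def sum.If_cases Int_def)
      also have "{x \<in> {1..n}. x \<in> D \<and> \<phi> s x \<notin> D} = {x \<in> D. \<phi> s x \<notin> D}"
        using D by auto
      also have "card {x \<in> {1..n}. x \<notin> D \<and> \<phi> s x \<in> D} = card {x \<in> D. \<phi> s x \<notin> D}"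
      proof -
        have pre: "{x \<in> {1..n}. \<phi> s x \<in> D} = inv' (\<phi> s) ` D"
        proof -
          have "inv' (\<phi> s) y \<in> {1..n}" if "y \<in> D" for y
            using that D permutes_in_image[OF permutes_inv[OF p]] by blast
          then show ?thesis
            using permutes_inverses[OF p] by (auto simp: image_iff) metis
        qed
        have "card {x \<in> {1..n}. \<phi> s x \<in> D} = card D"
          unfolding pre by (rule card_image) (metis permutes_inv[OF p] permutes_inj inj_on_subset subset_UNIV)
        moreover have "{x \<in> {1..n}. \<phi> s x \<in> D}
            = {x \<in> {1..n}. x \<notin> D \<and> \<phi> s x \<in> D} \<union> {x \<in> D. \<phi> s x \<in> D}"
          using D by auto
        then have "card {x \<in> {1..n}. \<phi> s x \<in> D}
            = card {x \<in> {1..n}. x \<notin> D \<and> \<phi> s x \<in> D} + card {x \<in> D. \<phi> s x \<in> D}"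
          using finD by (simp add: card_Un_disjoint disjoint_iff)
        moreover have "D = {x \<in> D. \<phi> s x \<notin> D} \<union> {x \<in> D. \<phi> s x \<in> D}" by auto
        then have "card D = card {x \<in> D. \<phi> s x \<notin> D} + card {x \<in> D. \<phi> s x \<in> D}"
          using finD by (subst card_Un_disjoint[symmetric]) auto
        ultimately show ?thesis by linarith
      qed
      finally have "(cvec_norm (?\<rho> s *\<^sub>v fun_vec n u - fun_vec n u))\<^sup>2 \<le> 2 * \<delta> * card D"
        using small[OF s] by simp
      also have "\<dots> = (\<kappa> / 4 * cvec_norm (fun_vec n u))\<^sup>2"
        by (simp add: power_mult_distrib norm_u \<delta>_def power_divide)
      finally show "(cvec_norm (?\<rho> s *\<^sub>v fun_vec n u - fun_vec n u))\<^sup>2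
        \<le> (\<kappa> / 4 * cvec_norm (fun_vec n u))\<^sup>2" .
    qed (use \<kappa> norm_nonneg[OF fun_vec_carrier] in simp)
    then have "cvec_norm (fun_vec n u - fun_vec n w) \<le> \<kappa> / 4 / \<kappa> * cvec_norm (fun_vec n u)"
      unfolding proj[symmetric] using \<kappa>
      by (intro tau Group.hom_compose[OF \<phi> perm_matrix_hom] fun_vec_carrier
          factors_through_finite_quotient_perm_matrix[OF group_axioms \<phi>]) auto
    then have "(cvec_norm (fun_vec n u - fun_vec n w))\<^sup>2 \<le> (1 / 4 * cvec_norm (fun_vec n u))\<^sup>2"
      using \<kappa> norm_nonneg[of "fun_vec n u - fun_vec n w" n] by (intro power_mono) auto
    then have upper: "(cvec_norm (fun_vec n u - fun_vec n w))\<^sup>2 \<le> card D / 16"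
      by (simp add: power_mult_distrib norm_u power_divide)
    show "\<exists>x\<in>D. card ?A < 2 * card {p \<in> ?A. p x \<in> D}"
    proof (rule ccontr)
      assume "\<not> ?thesis"
      then have le: "2 * card {p \<in> ?A. p x \<in> D} \<le> card ?A" if "x \<in> D" for x
        using that by auto
      have "1 / 4 \<le> (cmod (u x - w x))\<^sup>2" if x: "x \<in> D" for x
      proof -
        define r where "r = real (card {p \<in> ?A. p x \<in> D}) / card ?A"
        have "(\<Sum>p\<in>?A. u (p x)) = card {p \<in> ?A. p x \<in> D}"
          using finA by (simp add: u_def of_bool_def sum.If_cases Int_def)
        then have "u x - w x = of_real (1 - r)"
          using x by (simp add: u_def w_def r_def)
        moreover have "r \<le> 1 / 2"
          using le[OF x] cardA by (simp add: r_def field_simps)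
        ultimately have "1 / 2 \<le> cmod (u x - w x)"
          by (simp only: norm_of_real)
        then have "(1 / 2)\<^sup>2 \<le> (cmod (u x - w x))\<^sup>2" by (intro power_mono) auto
        then show ?thesis by (simp add: power_divide)
      qed
      then have "(\<Sum>x\<in>D. 1 / 4) \<le> (\<Sum>x\<in>D. (cmod (u x - w x))\<^sup>2)"
        by (intro sum_mono)
      also have "\<dots> \<le> (\<Sum>x\<in>{1..n}. (cmod (u x - w x))\<^sup>2)"
        using D by (intro sum_mono2) auto
      finally have "card D / 4 \<le> (cvec_norm (fun_vec n u - fun_vec n w))\<^sup>2"
        by (simp add: fun_vec_minus cvec_norm_fun_vec)
      with upper cardD show False by simp
    qed
  qed
qed

text \<open>If \<open>h\<close> were close to \<open>F\<close>, the diagonal of \<open>{1..n} \<times> {1..Suc n}\<close> would be almost invariant, so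
  for some \<open>x\<close> more than half of the elements \<open>p\<close> of the acting finite group satisfy
  \<open>h p x = F p x\<close>. Comparing such \<open>p\<close> with \<open>p b\<close> shows that the stabilizer of \<open>x\<close> under \<open>h\<close> is
  contained in the one under \<open>F\<close>, so the \<open>h\<close>-orbit of \<open>x\<close> has at least \<open>Suc n\<close> elements.\<close>

lemma (in group) property_tau_transitive_far:
  assumes "S \<subseteq> carrier G" and "property_tau G S"
  obtains \<delta> :: real where "\<delta> > 0"
    and "\<And>n F h. n > 0 \<Longrightarrow> F \<in> hom G (sym_group (Suc n)) \<Longrightarrow> h \<in> hom G (sym_group n) \<Longrightarrow>
      (\<And>x y. x \<in> {1..Suc n} \<Longrightarrow> y \<in> {1..Suc n} \<Longrightarrow> \<exists>g\<in>carrier G. F g x = y) \<Longrightarrow>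
      \<exists>s\<in>S. card {x \<in> {1..n}. h s x \<noteq> F s x} > \<delta> * n"
proof -
  obtain \<delta> :: real where \<delta>: "\<delta> > 0"
    and tau: "\<And>N \<phi> D. \<phi> \<in> hom G (sym_group N) \<Longrightarrow> D \<subseteq> {1..N} \<Longrightarrow> D \<noteq> {} \<Longrightarrow>
      (\<And>s. s \<in> S \<Longrightarrow> card {x \<in> D. \<phi> s x \<notin> D} \<le> \<delta> * card D) \<Longrightarrow>
      \<exists>x\<in>D. card (\<phi> ` carrier G) < 2 * card {p \<in> \<phi> ` carrier G. p x \<in> D}"
    using property_tau_almost_invariant_subset[OF group_axioms assms] by blast
  show thesis
  proof (rule that[OF \<delta>], rule ccontr)
    fix n F h
    assume n: "n > 0" and F: "F \<in> hom G (sym_group (Suc n))" and h: "h \<in> hom G (sym_group n)"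
      and trans: "\<And>x y. x \<in> {1..Suc n} \<Longrightarrow> y \<in> {1..Suc n} \<Longrightarrow> \<exists>g\<in>carrier G. F g x = y"
      and "\<not> (\<exists>s\<in>S. card {x \<in> {1..n}. h s x \<noteq> F s x} > \<delta> * n)"
    then have close: "card {x \<in> {1..n}. h s x \<noteq> F s x} \<le> \<delta> * n" if "s \<in> S" for s
      using that by fastforce
    let ?X = "{1..n} \<times> {1..Suc n}"
    let ?\<alpha> = "\<lambda>g (x, y). (h g x, F g y)"
    have h_in: "h g x \<in> {1..n} \<longleftrightarrow> x \<in> {1..n}" if "g \<in> carrier G" for g x
      by (rule permutes_in_image[OF sym_group_homD(1)[OF h that]])
    have F_in: "F g x \<in> {1..Suc n} \<longleftrightarrow> x \<in> {1..Suc n}" if "g \<in> carrier G" for g x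
      by (rule permutes_in_image[OF sym_group_homD(1)[OF F that]])
    have fin: "finite ?X" by simp
    have closed: "?\<alpha> g z \<in> ?X" if "g \<in> carrier G" "z \<in> ?X" for g z
    proof (cases z)
      case (Pair x y)
      then show ?thesis using that(2) h_in[OF that(1), of x] F_in[OF that(1), of y]
        by (simp del: atLeastAtMost_iff)
    qed
    have one: "?\<alpha> \<one> z = z" if "z \<in> ?X" for z
      by (cases z) (simp add: sym_group_homD(3)[OF h group_axioms] sym_group_homD(3)[OF F group_axioms])
    have mult: "?\<alpha> (g \<otimes> g') z = ?\<alpha> g (?\<alpha> g' z)" if "g \<in> carrier G" "g' \<in> carrier G" "z \<in> ?X" for g g' z
      by (cases z) (simp add: sym_group_homD(2)[OF h that(1,2)] sym_group_homD(2)[OF F that(1,2)])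
    obtain e \<phi> where e: "bij_betw e {1..card ?X} ?X"
      and \<phi>: "\<phi> \<in> hom G (sym_group (card ?X))"
      and eq: "\<And>g i. g \<in> carrier G \<Longrightarrow> i \<in> {1..card ?X} \<Longrightarrow> e (\<phi> g i) = ?\<alpha> g (e i)"
      by (rule finite_action_hom_sym_group[of ?X ?\<alpha>, OF fin closed one mult]) (assumption+, rule that)
    let ?I = "{1..card ?X}"
    define D where "D = {i \<in> ?I. fst (e i) = snd (e i)}"
    have D_I: "D \<subseteq> ?I" by (auto simp: D_def)
    have \<phi>_in: "\<phi> g i \<in> ?I" if "g \<in> carrier G" "i \<in> ?I" for g i
      using permutes_in_image[OF sym_group_homD(1)[OF \<phi> that(1)]] that(2) by blast
    have \<phi>_D: "\<phi> g i \<in> D \<longleftrightarrow> h g (fst (e i)) = F g (snd (e i))" if "g \<in> carrier G" "i \<in> ?I" for g i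
      unfolding D_def using \<phi>_in[OF that] eq[OF that]
      by (simp add: case_prod_unfold del: atLeastAtMost_iff)
    have bij_D: "bij_betw (\<lambda>i. fst (e i)) {i \<in> D. P (e i)} {x \<in> {1..n}. P (x, x)}" for P
    proof (rule bij_betw_imageI)
      show "inj_on (\<lambda>i. fst (e i)) {i \<in> D. P (e i)}"
      proof (rule inj_onI)
        fix i j assume ij: "i \<in> {i \<in> D. P (e i)}" "j \<in> {i \<in> D. P (e i)}" "fst (e i) = fst (e j)"
        then have "e i = e j" by (simp add: D_def prod_eq_iff)
        moreover have "i \<in> ?I" "j \<in> ?I" using ij(1,2) D_I by blast+
        ultimately show "i = j" using inj_onD[OF bij_betw_imp_inj_on[OF e]] by blast
      qed
      show "(\<lambda>i. fst (e i)) ` {i \<in> D. P (e i)} = {x \<in> {1..n}. P (x, x)}"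
      proof (intro equalityI subsetI)
        fix x assume "x \<in> (\<lambda>i. fst (e i)) ` {i \<in> D. P (e i)}"
        then obtain i where i: "i \<in> ?I" "fst (e i) = snd (e i)" "P (e i)" "x = fst (e i)"
          by (auto simp: D_def)
        have "e i \<in> ?X" using bij_betwE[OF e] i(1) by blast
        then have "x \<in> {1..n}" unfolding i(4) mem_Times_iff by (rule conjunct1)
        moreover have "e i = (x, x)" using i by (simp add: prod_eq_iff)
        ultimately show "x \<in> {x \<in> {1..n}. P (x, x)}" using i(3) by simp
      next
        fix x assume x: "x \<in> {x \<in> {1..n}. P (x, x)}"
        then have "(x, x) \<in> e ` ?I" unfolding bij_betw_imp_surj_on[OF e] by simp
        then obtain i where i: "(x, x) = e i" "i \<in> ?I" by (rule imageE)
        then show "x \<in> (\<lambda>i. fst (e i)) ` {i \<in> D. P (e i)}"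
          using x i(2) by (intro image_eqI[of _ _ i]) (simp_all add: D_def flip: i(1))
      qed
    qed
    have cardD: "card D = n"
      using bij_betw_same_card[OF bij_D[of "\<lambda>_. True"]] by (simp del: atLeastAtMost_iff)
    have "card {i \<in> D. \<phi> s i \<notin> D} \<le> \<delta> * card D" if s: "s \<in> S" for s
    proof -
      have sG: "s \<in> carrier G" using s assms(1) by blast
      have "{i \<in> D. \<phi> s i \<notin> D} = {i \<in> D. h s (fst (e i)) \<noteq> F s (snd (e i))}"
        using \<phi>_D[OF sG] D_I by blast
      then have "card {i \<in> D. \<phi> s i \<notin> D} = card {x \<in> {1..n}. h s x \<noteq> F s x}"
        using bij_betw_same_card[OF bij_D[of "\<lambda>z. h s (fst z) \<noteq> F s (snd z)"]]
        by (simp del: atLeastAtMost_iff)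
      then show ?thesis using close[OF s] cardD by simp
    qed
    moreover have "D \<noteq> {}" using cardD n by auto
    ultimately obtain i where i: "i \<in> D"
      and major: "card (\<phi> ` carrier G) < 2 * card {p \<in> \<phi> ` carrier G. p i \<in> D}"
      using tau[OF \<phi> D_I] by blast
    define A where "A = \<phi> ` carrier G"
    define M where "M = {p \<in> A. p i \<in> D}"
    have M_A: "M \<subseteq> A" by (simp add: M_def)
    define x where "x = fst (e i)"
    have iI: "i \<in> ?I" using i D_I by blast
    have "e i \<in> ?X" using bij_betwE[OF e] iI by blast
    then have x: "x \<in> {1..n}" unfolding x_def mem_Times_iff by (rule conjunct1)
    have snd_e: "snd (e i) = x" using i by (simp add: D_def x_def)
    have finA: "finite A" unfolding A_def
      using sym_group_homD(1)[OF \<phi>] by (intro finite_subset[OF _ finite_permutations[of ?I]]) auto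
    have stab: "F b x = x" if b: "b \<in> carrier G" and hb: "h b x = x" for b
    proof -
      define r where "r = (\<lambda>p::nat \<Rightarrow> nat. p \<circ> \<phi> b)"
      define M' where "M' = {p \<in> A. r p \<in> M}"
      have comp: "\<phi> a \<circ> \<phi> b = \<phi> (a \<otimes> b)" if "a \<in> carrier G" for a
        using sym_group_homD(2)[OF \<phi> that b] by (simp add: fun_eq_iff)
      have inj: "inj_on r A"
      proof (rule inj_onI)
        fix p q assume "r p = r q"
        then show "p = q" unfolding r_def
          by (intro surj_fun_eq[OF permutes_surj[OF sym_group_homD(1)[OF \<phi> b]]]) simp
      qed
      have "r ` A \<subseteq> A"
        using b by (auto simp: A_def r_def comp)
      then have img: "r ` A = A" by (rule endo_inj_surj[OF finA _ inj])
      have "r ` M' = M"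
      proof (rule equalityI)
        show "M \<subseteq> r ` M'"
        proof
          fix q assume q: "q \<in> M"
          then have "q \<in> r ` A" unfolding img using M_A by (rule rev_subsetD)
          then obtain p where "q = r p" "p \<in> A" by (rule imageE)
          then show "q \<in> r ` M'" using q by (intro image_eqI[of _ _ p]) (auto simp: M'_def)
        qed
      qed (auto simp: M'_def)
      moreover have M'_A: "M' \<subseteq> A" by (simp add: M'_def)
      ultimately have "card M' = card M"
        using card_image[OF inj_on_subset[OF inj M'_A]] by simp
      moreover have "card (M \<union> M') \<le> card A"
        using M_A M'_A by (intro card_mono[OF finA]) blast
      moreover have "card M + card M' = card (M \<union> M') + card (M \<inter> M')"
        using M_A M'_A finA finite_subset by (intro card_Un_Int) blast+
      ultimately have "card (M \<inter> M') > 0"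
        using major unfolding A_def[symmetric] M_def[symmetric] by linarith
      then have "M \<inter> M' \<noteq> {}" unfolding card_gt_0_iff by (rule conjunct1)
      then obtain p where "p \<in> A" "p i \<in> D" "r p i \<in> D" by (auto simp: M_def M'_def)
      then obtain a where a: "a \<in> carrier G" "\<phi> a i \<in> D" "(\<phi> a \<circ> \<phi> b) i \<in> D"
        by (auto simp: A_def r_def)
      have ab: "a \<otimes> b \<in> carrier G" using a(1) b by simp
      have "F a (F b x) = F (a \<otimes> b) x" by (rule sym_group_homD(2)[OF F a(1) b, symmetric])
      also have "\<dots> = h (a \<otimes> b) x"
        using a(3) unfolding comp[OF a(1)] \<phi>_D[OF ab iI] snd_e x_def[symmetric] by (rule sym)
      also have "\<dots> = h a x" by (simp add: sym_group_homD(2)[OF h a(1) b] hb)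
      also have "\<dots> = F a x" using a(2) unfolding \<phi>_D[OF a(1) iI] snd_e x_def[symmetric] .
      finally show ?thesis
        using permutes_inj[OF sym_group_homD(1)[OF F a(1)]] by (simp add: inj_eq)
    qed
    have xF: "x \<in> {1..Suc n}" using x by simp
    define c where "c y = (SOME g. g \<in> carrier G \<and> F g x = y)" for y
    have c: "c y \<in> carrier G" "F (c y) x = y" if "y \<in> {1..Suc n}" for y
      using someI_ex[of "\<lambda>g. g \<in> carrier G \<and> F g x = y"] trans[OF xF that] unfolding c_def by blast+
    have "inj_on (\<lambda>y. h (c y) x) {1..Suc n}"
    proof (rule inj_onI)
      fix y z assume y: "y \<in> {1..Suc n}" and z: "z \<in> {1..Suc n}" and hyz: "h (c y) x = h (c z) x"
      let ?b = "inv (c z) \<otimes> c y"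
      have b: "?b \<in> carrier G" using c y z by simp
      have zb: "c z \<otimes> ?b = c y" using c(1)[OF y] c(1)[OF z] by (simp add: inv_solve_left m_assoc[symmetric])
      have "h (c z) (h ?b x) = h (c z) x"
        using sym_group_homD(2)[OF h c(1)[OF z] b] hyz by (simp add: zb)
      then have "h ?b x = x"
        using permutes_inj[OF sym_group_homD(1)[OF h c(1)[OF z]]] by (simp add: inj_eq)
      then have "F ?b x = x" by (rule stab[OF b])
      then have "F (c y) x = F (c z) x"
        using sym_group_homD(2)[OF F c(1)[OF z] b] by (simp add: zb)
      then show "y = z" using c(2) y z by simp
    qed
    moreover have "(\<lambda>y. h (c y) x) ` {1..Suc n} \<subseteq> {1..n}"
      using h_in c(1) x by blast
    ultimately have "card {1..Suc n} \<le> card {1..n}"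
      by (rule card_inj_on_le) simp
    then show False by simp
  qed
qed

section \<open>Deleting a point from an action\<close>

definition delete_point :: "nat \<Rightarrow> (nat \<Rightarrow> nat) \<Rightarrow> nat \<Rightarrow> nat" where
  "delete_point n p = Transposition.transpose (Suc n) (p (Suc n)) \<circ> p"

lemma delete_point_permutes:
  assumes p: "p permutes {1..Suc n}"
  shows "delete_point n p permutes {1..n}"
proof -
  have "p (Suc n) \<in> {1..Suc n}" using permutes_in_image[OF p] by simp
  then have "delete_point n p permutes {1..Suc n}"
    unfolding delete_point_def
    by (intro permutes_compose[OF p] permutes_swap_id) auto
  then show ?thesis
  proof (rule permutes_superset)
    fix x assume "x \<in> {1..Suc n} - {1..n}"
    then have "x = Suc n" by auto
    then show "delete_point n p x = x" by (simp add: delete_point_def)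
  qed
qed

lemma delete_point_eq:
  assumes "p permutes {1..Suc n}" "x \<in> {1..n}" "p x \<noteq> Suc n"
  shows "delete_point n p x = p x"
proof -
  have "p x \<noteq> p (Suc n)"
    using inj_eq[OF permutes_inj[OF assms(1)], of x "Suc n"] assms(2) by simp
  then show ?thesis using assms(3) by (simp add: delete_point_def)
qed

lemma perm_dist_delete_point_compose:
  assumes p: "p permutes {1..Suc n}" and q: "q permutes {1..Suc n}"
  shows "perm_dist n (delete_point n (p \<circ> q)) (delete_point n p \<circ> delete_point n q) \<le> 2 / n"
proof -
  let ?B = "{inv' q (Suc n), inv' q (inv' p (Suc n))}"
  have pq: "p \<circ> q permutes {1..Suc n}" using permutes_compose[OF q p] .
  have "{x \<in> {1..n}. delete_point n (p \<circ> q) x \<noteq> (delete_point n p \<circ> delete_point n q) x} \<subseteq> ?B"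
  proof (rule subsetI, rule ccontr)
    fix x
    assume "x \<in> {x \<in> {1..n}. delete_point n (p \<circ> q) x \<noteq> (delete_point n p \<circ> delete_point n q) x}"
      and notin: "x \<notin> ?B"
    then have x: "x \<in> {1..n}"
      and ne: "delete_point n (p \<circ> q) x \<noteq> delete_point n p (delete_point n q x)" by auto
    from notin have "x \<noteq> inv' q (inv' p (Suc n))" "x \<noteq> inv' q (Suc n)" by auto
    then have "q x \<noteq> Suc n" "p (q x) \<noteq> Suc n"
      using permutes_inverses[OF p] permutes_inverses[OF q] by metis+
    moreover from this have "q x \<in> {1..n}"
      using x permutes_in_image[OF q, of x] by auto
    ultimately have "delete_point n (p \<circ> q) x = p (q x)"
      "delete_point n p (delete_point n q x) = p (q x)"
      using x delete_point_eq[OF pq x] delete_point_eq[OF q x] delete_point_eq[OF p, of "q x"] by auto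
    then show False
      using ne by simp
  qed
  then have "card {x \<in> {1..n}. delete_point n (p \<circ> q) x \<noteq> (delete_point n p \<circ> delete_point n q) x} \<le> card ?B"
    by (intro card_mono) auto
  also have "\<dots> \<le> 2" by (simp add: card_insert_if)
  finally show ?thesis
    unfolding perm_dist_def by (intro divide_right_mono) auto
qed

lemma tv_dist_map_pmf_of_set_le:
  assumes A: "finite A" "A \<noteq> {}" and \<Omega>: "finite \<Omega>"
  shows "tv_dist \<Omega> (map_pmf u (pmf_of_set A)) (map_pmf w (pmf_of_set A))
    \<le> card {x \<in> A. u x \<noteq> w x} / card A"
proof -
  have pmf: "pmf (map_pmf v (pmf_of_set A)) y = (\<Sum>x\<in>A. of_bool (v x = y)) / card A" for v :: "'a \<Rightarrow> 'b" and y
    using A by (simp add: pmf_map measure_pmf_of_set of_bool_def sum.If_cases Int_def vimage_def)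
  have one: "(\<Sum>y\<in>\<Omega>. of_bool (a = y)) \<le> (1::real)" for a
    using \<Omega> by (simp add: of_bool_def)
  have "(\<Sum>y\<in>\<Omega>. \<bar>pmf (map_pmf u (pmf_of_set A)) y - pmf (map_pmf w (pmf_of_set A)) y\<bar>)
      = (\<Sum>y\<in>\<Omega>. \<bar>\<Sum>x\<in>A. of_bool (u x = y) - of_bool (w x = y)\<bar>) / card A"
    by (simp add: pmf sum_subtractf abs_divide flip: diff_divide_distrib sum_divide_distrib)
  also have "\<dots> \<le> (\<Sum>y\<in>\<Omega>. \<Sum>x\<in>A. of_bool (u x \<noteq> w x) * (of_bool (u x = y) + of_bool (w x = y))) / card A"
    by (intro divide_right_mono sum_mono order_trans[OF sum_abs]) (auto split: if_splits)
  also have "\<dots> = (\<Sum>x\<in>A. of_bool (u x \<noteq> w x) * ((\<Sum>y\<in>\<Omega>. of_bool (u x = y)) + (\<Sum>y\<in>\<Omega>. of_bool (w x = y)))) / card A"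
    by (subst sum.swap) (simp add: sum.distrib flip: sum_distrib_left)
  also have "\<dots> \<le> (\<Sum>x\<in>A. of_bool (u x \<noteq> w x) * 2) / card A"
  proof (intro divide_right_mono sum_mono mult_left_mono)
    show "(\<Sum>y\<in>\<Omega>. of_bool (u x = y)) + (\<Sum>y\<in>\<Omega>. of_bool (w x = y)) \<le> (2::real)" for x
      using one[of "u x"] one[of "w x"] by linarith
  qed auto
  also have "\<dots> = 2 * (card {x \<in> A. u x \<noteq> w x} / card A)"
    using A by (simp add: of_bool_def sum.If_cases Int_def flip: sum_distrib_right)
  finally show ?thesis unfolding tv_dist_def by linarith
qed

lemma (in group) property_tau_deleted_point_far:
  assumes S: "finite S" "S \<subseteq> carrier G" and tau: "property_tau G S"
    and n: "\<And>l. n l > 0" "filterlim n at_top sequentially"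
    and F: "\<And>l. F l \<in> hom G (sym_group (Suc (n l)))"
    and trans: "\<And>l x y. x \<in> {1..Suc (n l)} \<Longrightarrow> y \<in> {1..Suc (n l)} \<Longrightarrow> \<exists>g\<in>carrier G. F l g x = y"
  shows "\<not> close_to_homs G n (\<lambda>l g. delete_point (n l) (F l g))"
proof
  let ?f = "\<lambda>l g. delete_point (n l) (F l g)"
  assume "close_to_homs G n ?f"
  then obtain h where h: "\<And>l. h l \<in> hom G (sym_group (n l))"
    and lim: "\<And>g. g \<in> carrier G \<Longrightarrow> (\<lambda>l. perm_dist (n l) (?f l g) (h l g)) \<longlonglongrightarrow> 0"
    unfolding close_to_homs_def by auto
  obtain \<delta> :: real where \<delta>: "\<delta> > 0"
    and far: "\<And>n F h. n > 0 \<Longrightarrow> F \<in> hom G (sym_group (Suc n)) \<Longrightarrow> h \<in> hom G (sym_group n) \<Longrightarrow>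
      (\<And>x y. x \<in> {1..Suc n} \<Longrightarrow> y \<in> {1..Suc n} \<Longrightarrow> \<exists>g\<in>carrier G. F g x = y) \<Longrightarrow>
      \<exists>s\<in>S. card {x \<in> {1..n}. h s x \<noteq> F s x} > \<delta> * n"
    using property_tau_transitive_far[OF S(2) tau] by blast
  have "\<forall>\<^sub>F l in sequentially. \<forall>s\<in>S. perm_dist (n l) (?f l s) (h l s) < \<delta> / 2"
    using S \<delta> by (intro eventually_ball_finite ballI order_tendstoD(2)[OF lim]) auto
  moreover have "\<forall>\<^sub>F l in sequentially. nat \<lceil>2 / \<delta>\<rceil> \<le> n l"
    using n(2) unfolding filterlim_at_top by (rule spec)
  ultimately have "\<forall>\<^sub>F l in sequentially. (\<forall>s\<in>S. perm_dist (n l) (?f l s) (h l s) < \<delta> / 2) \<and> nat \<lceil>2 / \<delta>\<rceil> \<le> n l"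
    by (rule eventually_conj)
  then obtain l where l: "\<And>s. s \<in> S \<Longrightarrow> perm_dist (n l) (?f l s) (h l s) < \<delta> / 2" "nat \<lceil>2 / \<delta>\<rceil> \<le> n l"
    using eventually_happens'[OF sequentially_bot] by blast
  have "2 / \<delta> \<le> n l" using l(2) by linarith
  then have n_large: "1 \<le> \<delta> / 2 * n l" using \<delta> by (simp add: field_simps)
  obtain s where s: "s \<in> S" and gt: "card {x \<in> {1..n l}. h l s x \<noteq> F l s x} > \<delta> * n l"
    using far[OF n(1) F h trans] by blast
  have p: "F l s permutes {1..Suc (n l)}"
    using sym_group_homD(1)[OF F] s S(2) by blast
  have "{x \<in> {1..n l}. h l s x \<noteq> F l s x}
      \<subseteq> insert (inv' (F l s) (Suc (n l))) {x \<in> {1..n l}. ?f l s x \<noteq> h l s x}"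
  proof
    fix x assume "x \<in> {x \<in> {1..n l}. h l s x \<noteq> F l s x}"
    then show "x \<in> insert (inv' (F l s) (Suc (n l))) {x \<in> {1..n l}. ?f l s x \<noteq> h l s x}"
      using delete_point_eq[OF p, of x] permutes_inverses(2)[OF p, of x]
      by (cases "F l s x = Suc (n l)") auto
  qed
  then have "card {x \<in> {1..n l}. h l s x \<noteq> F l s x}
      \<le> card (insert (inv' (F l s) (Suc (n l))) {x \<in> {1..n l}. ?f l s x \<noteq> h l s x})"
    by (rule card_mono[rotated]) simp
  also have "\<dots> \<le> Suc (card {x \<in> {1..n l}. ?f l s x \<noteq> h l s x})"
    by (simp add: card_insert_if)
  finally have "real (card {x \<in> {1..n l}. h l s x \<noteq> F l s x})
      \<le> 1 + card {x \<in> {1..n l}. ?f l s x \<noteq> h l s x}" by linarith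
  moreover have "card {x \<in> {1..n l}. ?f l s x \<noteq> h l s x} < \<delta> / 2 * n l"
    using l(1)[OF s] n(1)[of l] by (simp add: perm_dist_def field_simps)
  moreover have "\<delta> / 2 * n l + \<delta> / 2 * n l = \<delta> * n l" by simp
  ultimately show False using gt n_large by linarith
qed

lemma (in group) asymptotic_hom_delete_point:
  assumes n: "\<And>l. n l > 0" "filterlim n at_top sequentially"
    and F: "\<And>l. F l \<in> hom G (sym_group (Suc (n l)))"
  shows "asymptotic_hom G n (\<lambda>l g. delete_point (n l) (F l g))"
  unfolding asymptotic_hom_def
proof (intro conjI allI ballI)
  show "(\<lambda>g. delete_point (n l) (F l g)) \<in> carrier G \<rightarrow> carrier (sym_group (n l))" for l
    using delete_point_permutes sym_group_homD(1)[OF F] by (simp add: sym_group_carrier)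
next
  fix g h assume gh: "g \<in> carrier G" "h \<in> carrier G"
  have "F l (g \<otimes> h) = F l g \<circ> F l h" for l
    using sym_group_homD(2)[OF F gh] by (simp add: fun_eq_iff)
  then have le: "perm_dist (n l) (delete_point (n l) (F l (g \<otimes> h)))
      (delete_point (n l) (F l g) \<otimes>\<^bsub>sym_group (n l)\<^esub> delete_point (n l) (F l h)) \<le> 2 / n l" for l
    using perm_dist_delete_point_compose[OF sym_group_homD(1)[OF F gh(1)] sym_group_homD(1)[OF F gh(2)]]
    by (simp add: sym_group_mult)
  have "filterlim (\<lambda>l. real (n l)) at_top sequentially"
    by (rule filterlim_compose[OF filterlim_real_sequentially n(2)])
  then have "(\<lambda>l. 2 / real (n l)) \<longlonglongrightarrow> 0"
    by (intro tendsto_divide_0[OF tendsto_const] filterlim_at_top_imp_at_infinity)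
  from tendsto_sandwich[OF _ _ tendsto_const this]
  show "(\<lambda>l. perm_dist (n l) (delete_point (n l) (F l (g \<otimes> h)))
      (delete_point (n l) (F l g) \<otimes>\<^bsub>sym_group (n l)\<^esub> delete_point (n l) (F l h))) \<longlonglongrightarrow> 0"
    using le by (simp add: perm_dist_def)
qed (use n in auto)

lemma (in group) not_BS_rigid:
  assumes S: "finite S" "S \<subseteq> carrier G" and tau: "property_tau G S"
    and inf: "infinite {H. subgroup H G \<and> finite (rcosets H)}"
  shows "\<not> BS_rigid G"
proof -
  obtain K :: "nat \<Rightarrow> 'a set" where K: "\<And>i. K i \<lhd> G" "\<And>i. finite (rcosets (K i))"
    and K_Suc: "\<And>i. K (Suc i) \<subset> K i"
    by (rule finite_index_normal_chain[OF inf]) (rule that)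
  note subgr = normal_imp_subgroup[OF K(1)]
  have K_anti: "K i' \<subseteq> K i" if "i \<le> i'" for i i'
    using lift_Suc_antimono_le[of K, OF psubset_imp_subset[OF K_Suc] that] .
  define m where "m i = card (rcosets (K i))" for i
  have "strict_mono m"
    unfolding strict_mono_Suc_iff m_def
    using card_rcosets_strict_antimono[OF subgr K(2) subgr K_Suc] by blast
  then have m_ge: "i \<le> m i" for i by (rule strict_mono_imp_increasing)
  have m_pos: "m i > 0" for i
    using K(2)[of i] subgroup.subgroup_in_rcosets[OF subgr group_axioms, of i]
    unfolding m_def card_gt_0_iff by blast
  have "\<exists>\<phi>. \<phi> \<in> hom G (sym_group (m i)) \<and>
      (\<forall>g\<in>carrier G. \<forall>x\<in>{1..m i}. \<phi> g x = x \<longleftrightarrow> g \<in> K i) \<and>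
      (\<forall>x\<in>{1..m i}. \<forall>y\<in>{1..m i}. \<exists>g\<in>carrier G. \<phi> g x = y)" for i
    unfolding m_def by (rule normal_quotient_action[OF K(1)[of i] K(2)[of i]]) (intro exI conjI ballI; simp)
  then obtain \<phi> where \<phi>: "\<And>i. \<phi> i \<in> hom G (sym_group (m i))"
    and fixed: "\<And>i g x. g \<in> carrier G \<Longrightarrow> x \<in> {1..m i} \<Longrightarrow> \<phi> i g x = x \<longleftrightarrow> g \<in> K i"
    and trans: "\<And>i x y. x \<in> {1..m i} \<Longrightarrow> y \<in> {1..m i} \<Longrightarrow> \<exists>g\<in>carrier G. \<phi> i g x = y"
    by metis
  define j where "j l = Suc l * m l + Suc l" for l
  define n where "n l = m (j l) - 1" for l
  have n_ge: "n l \<ge> Suc l * m l + l" for l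
    using m_ge[of "j l"] by (simp add: n_def j_def)
  have n_pos: "n l > 0" for l
    using n_ge[of l] m_pos[of l] by simp
  have Suc_n: "m (j l) = Suc (n l)" for l
    using n_pos[of l] by (simp add: n_def)
  have n_top: "filterlim n at_top sequentially"
    by (intro filterlim_at_top_mono[OF filterlim_ident] always_eventually allI add_leD2[OF n_ge])
  define F where "F l = \<phi> (j l)" for l
  have F: "F l \<in> hom G (sym_group (Suc (n l)))" for l
    using \<phi>[of "j l"] by (simp add: F_def Suc_n)
  have F_trans: "\<exists>g\<in>carrier G. F l g x = y" if "x \<in> {1..Suc (n l)}" "y \<in> {1..Suc (n l)}" for l x y
    using trans[of x "j l" y] that by (simp add: F_def Suc_n)
  have F_fixed: "F l g x = x \<longleftrightarrow> g \<in> K (j l)" if "g \<in> carrier G" "x \<in> {1..Suc (n l)}" for l g x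
    using fixed[of g x "j l"] that by (simp add: F_def Suc_n)
  let ?f = "\<lambda>l g. delete_point (n l) (F l g)"
  have "\<exists>\<psi>. \<psi> \<in> hom G (sym_group (n l)) \<and>
      (\<forall>x\<in>{1..n l div m l * m l}. \<exists>y\<in>{1..m l}. \<forall>g\<in>carrier G. \<psi> g x = x \<longleftrightarrow> \<phi> l g y = y)" for l
  proof (rule replicated_action[OF \<phi>[of l] m_pos[of l], of "n l"])
    fix \<psi>
    assume \<psi>: "\<psi> \<in> hom G (sym_group (n l))" "\<And>x. x \<in> {1..n l div m l * m l} \<Longrightarrow>
      \<exists>y\<in>{1..m l}. \<forall>g\<in>carrier G. \<psi> g x = x \<longleftrightarrow> \<phi> l g y = y"
    show ?thesis by (intro exI[of _ \<psi>] conjI ballI \<psi>)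
  qed
  then obtain k where k: "\<And>l. k l \<in> hom G (sym_group (n l))"
    and k_fixed: "\<And>l x. x \<in> {1..n l div m l * m l} \<Longrightarrow>
      \<exists>y\<in>{1..m l}. \<forall>g\<in>carrier G. k l g x = x \<longleftrightarrow> \<phi> l g y = y"
    by metis
  have "(\<lambda>l. tv_dist (Pow Q) (stabilizer_distr (n l) (?f l) Q) (stabilizer_distr (n l) (k l) Q)) \<longlonglongrightarrow> 0"
    if Q: "finite Q" "Q \<subseteq> carrier G" for Q
  proof (rule tendsto_sandwich[OF _ _ tendsto_const])
    show "\<forall>\<^sub>F l in sequentially.
      0 \<le> tv_dist (Pow Q) (stabilizer_distr (n l) (?f l) Q) (stabilizer_distr (n l) (k l) Q)"
      by (simp add: tv_dist_def sum_nonneg)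
    have "\<forall>\<^sub>F l in sequentially. g \<in> K (j l) \<longleftrightarrow> g \<in> K l" for g
    proof (cases "\<forall>i. g \<in> K i")
      case False
      then obtain i where i: "g \<notin> K i" by blast
      have "g \<notin> K i'" if "i \<le> i'" for i' using i K_anti[OF that] by blast
      moreover have "l \<le> j l" for l by (simp add: j_def)
      ultimately show ?thesis
        unfolding eventually_sequentially by (meson order_trans)
    qed simp
    then have "\<forall>\<^sub>F l in sequentially. \<forall>g\<in>Q. g \<in> K (j l) \<longleftrightarrow> g \<in> K l"
      using Q by (intro eventually_ball_finite) auto
    then show "\<forall>\<^sub>F l in sequentially.
      tv_dist (Pow Q) (stabilizer_distr (n l) (?f l) Q) (stabilizer_distr (n l) (k l) Q)
        \<le> card Q / n l + 1 / Suc l"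
    proof eventually_elim
      case (elim l)
      let ?u = "\<lambda>x. {g \<in> Q. ?f l g x = x}" and ?w = "\<lambda>x. {g \<in> Q. k l g x = x}"
      let ?B = "(\<lambda>g. inv' (F l g) (Suc (n l))) ` Q"
      let ?C = "{n l div m l * m l<..n l}"
      have "{x \<in> {1..n l}. ?u x \<noteq> ?w x} \<subseteq> ?B \<union> ?C"
      proof (rule subsetI, rule ccontr)
        fix x assume "x \<in> {x \<in> {1..n l}. ?u x \<noteq> ?w x}" and notin: "x \<notin> ?B \<union> ?C"
        then have x: "x \<in> {1..n l}" and ne: "?u x \<noteq> ?w x" by auto
        have "x \<in> {1..n l div m l * m l}" using x notin by auto
        from k_fixed[OF this] obtain y
          where y: "y \<in> {1..m l}" "\<forall>g\<in>carrier G. k l g x = x \<longleftrightarrow> \<phi> l g y = y"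
          by (rule bexE)
        have "?f l g x = x \<longleftrightarrow> k l g x = x" if g: "g \<in> Q" for g
        proof -
          have gG: "g \<in> carrier G" using g Q by blast
          note p = sym_group_homD(1)[OF F gG, of l]
          have "F l g x \<noteq> Suc (n l)"
          proof
            assume "F l g x = Suc (n l)"
            then have "x = inv' (F l g) (Suc (n l))"
              using permutes_inverses(2)[OF p, of x] by simp
            then have "x \<in> ?B" using g by (rule image_eqI)
            with notin show False by simp
          qed
          then have "?f l g x = F l g x" by (rule delete_point_eq[OF p x])
          moreover have "F l g x = x \<longleftrightarrow> g \<in> K (j l)" using F_fixed[OF gG] x by simp
          ultimately show ?thesis
            using bspec[OF elim g] bspec[OF y(2) gG] fixed[OF gG y(1)] by simp
        qed
        then have "?u x = ?w x" by blast
        with ne show False ..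
      qed
      then have "card {x \<in> {1..n l}. ?u x \<noteq> ?w x} \<le> card (?B \<union> ?C)"
        using Q by (intro card_mono) auto
      also have "\<dots> \<le> card ?B + card ?C" by (rule card_Un_le)
      also have "\<dots> \<le> card Q + m l"
      proof (rule add_mono)
        show "card ?B \<le> card Q" using Q by (intro card_image_le)
        have "card ?C = n l mod m l" by (simp add: minus_div_mult_eq_mod)
        then show "card ?C \<le> m l" using m_pos[of l] by (simp add: less_imp_le)
      qed
      finally have card: "card {x \<in> {1..n l}. ?u x \<noteq> ?w x} \<le> card Q + m l" .
      have "tv_dist (Pow Q) (stabilizer_distr (n l) (?f l) Q) (stabilizer_distr (n l) (k l) Q)
          \<le> card {x \<in> {1..n l}. ?u x \<noteq> ?w x} / card {1..n l}"
        unfolding stabilizer_distr_def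
        using Q n_pos[of l] by (intro tv_dist_map_pmf_of_set_le) auto
      also have "\<dots> \<le> (card Q + m l) / n l"
        using card by (simp add: divide_right_mono)
      also have "\<dots> = card Q / n l + m l / n l"
        by (simp add: add_divide_distrib)
      also have "m l / n l \<le> 1 / Suc l"
      proof -
        have "Suc l * m l \<le> n l" using n_ge[of l] by simp
        then have "real (Suc l) * m l \<le> n l" by (simp only: of_nat_mult[symmetric] of_nat_le_iff)
        then show ?thesis using n_pos[of l] by (simp add: field_simps)
      qed
      finally show ?case by simp
    qed
    have "filterlim (\<lambda>l. real (n l)) at_top sequentially"
      by (rule filterlim_compose[OF filterlim_real_sequentially n_top])
    then have "(\<lambda>l. card Q / real (n l)) \<longlonglongrightarrow> 0"
      by (intro tendsto_divide_0[OF tendsto_const] filterlim_at_top_imp_at_infinity)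
    from tendsto_add[OF this LIMSEQ_Suc[OF lim_1_over_n]]
    show "(\<lambda>l. card Q / n l + 1 / Suc l) \<longlonglongrightarrow> 0" by simp
  qed
  then show ?thesis
    unfolding BS_rigid_def
    using asymptotic_hom_delete_point[OF n_pos n_top F] k
      property_tau_deleted_point_far[OF S tau n_pos n_top F F_trans] by blast
qed

lemma stable_imp_BS_rigid: "stable_in_permutations G \<Longrightarrow> BS_rigid G"
  by (simp add: stable_in_permutations_def BS_rigid_def)

lemma (in group) stable_sofic_residually_finite:
  assumes "sofic G" and stable: "stable_in_permutations G" and g: "g \<in> carrier G" "g \<noteq> \<one>"
  shows "\<exists>H. subgroup H G \<and> finite (rcosets H) \<and> g \<notin> H"
proof -
  obtain n f where f: "asymptotic_hom G n f"
    and sep: "(\<lambda>l. perm_dist (n l) (f l g) id) \<longlonglongrightarrow> 1"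
    using \<open>sofic G\<close> g unfolding sofic_def by blast
  obtain h where h: "\<And>l. h l \<in> hom G (sym_group (n l))"
    and lim: "(\<lambda>l. perm_dist (n l) (f l g) (h l g)) \<longlonglongrightarrow> 0"
    using stable f g(1) unfolding stable_in_permutations_def close_to_homs_def by blast
  have "\<exists>l. h l g \<noteq> id"
  proof (rule ccontr)
    assume "\<nexists>l. h l g \<noteq> id"
    then have "(\<lambda>l. perm_dist (n l) (f l g) id) \<longlonglongrightarrow> 0" using lim by simp
    from LIMSEQ_unique[OF this sep] show False by simp
  qed
  then obtain l where "h l g \<noteq> id" ..
  then have "g \<notin> kernel G (sym_group (n l)) (h l)"
    by (simp add: kernel_def sym_group_one)
  then show ?thesis
    using finite_index_kernel[OF h] normal_imp_subgroup by blast
qed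

theorem theorem1p15:
  fixes G :: "('a, 'b) monoid_scheme" and S :: "'a set"
  assumes "group G"
    and "finite S" and "S \<subseteq> carrier G" and "generate G S = carrier G"
    and "property_tau G S"
  shows "(infinite {H. subgroup H G \<and> finite (rcosets\<^bsub>G\<^esub> H)} \<longrightarrow> \<not> BS_rigid G) \<and>
    (infinite (carrier G) \<and> sofic G \<longrightarrow> \<not> stable_in_permutations G)"
proof (intro conjI impI notI)
  interpret group G by fact
  show False if "infinite {H. subgroup H G \<and> finite (rcosets\<^bsub>G\<^esub> H)}" "BS_rigid G"
    using not_BS_rigid[OF assms(2,3,5)] that by blast
  show False if "infinite (carrier G) \<and> sofic G" "stable_in_permutations G"
    using not_BS_rigid[OF assms(2,3,5) residually_finite_infinite_finite_index]
      stable_sofic_residually_finite stable_imp_BS_rigid that by blast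
qed

end
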